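(* Consider the linear stochastic Schr\"odinger equation $\mathrm{i}\,\mathrm{d}u-\Delta u\,\mathrm{d}t=\mathrm{d}W$ on $\mathbb{R}^d\times(0,\infty)$, $u(0)=u_0$, where $u_0$ is an $\mathcal{F}_0$-measurable $L^2$-valued random variable and $W$ is a $Q$-Wiener process. Let $k>0$, $t_n=nk$, and let $u^n$ be the exponential integrator defined by $u^0=u_0$ and $$u^n=S(k)u^{n-1}-\mathrm{i}S(k)\bigl(W(t_n)-W(t_{n-1})\bigr),\qquad n\ge1.$$ Let $H(u)=\frac12\int_{\mathbb{R}^d}|\nabla u|^2\,\mathrm{d}x$. Assume that $\mathbb{E}[H(u_0)]$ is finite and that $\|\nabla Q^{1/2}\|_{\mathcal{L}_2^0}$ is finite. Then, for all $n\ge1$, $$\mathbb{E}[H(u^n)]=\mathbb{E}[H(u^{n-1})]+\frac k2\,\mathrm{Tr}(\nabla Q\nabla)=\mathbb{E}[H(u_0)]+\frac{t_n}{2}\,\mathrm{Tr}(\nabla Q\nabla).$$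
   Context: $d\ge1$ is arbitrary. $L^2=L^2(\mathbb{R}^d)$ is the space of complex-valued square integrable functions, with inner product $(u,v)=\mathrm{Re}\int_{\mathbb{R}^d}u\bar v\,\mathrm{d}x$. $S(t)=\mathrm{e}^{-\mathrm{i}t\Delta}$ is the unitary group generated by $-\mathrm{i}\Delta$. $(\Omega,\mathcal{F},\mathbb{P},\{\mathcal{F}_t\}_{t\ge0})$ is a filtered probability space with a normal filtration; $Q$ is a nonnegative self-adjoint trace-class operator on $L^2$, and $W$ is a complex-valued (i.e. $L^2$-valued), square integrable $Q$-Wiener process with respect to $\{\mathcal{F}_t\}$, so $W(t)=\sum_j\beta_j(t)Q^{1/2}e_j$ for an orthonormal basis $(e_j)$ of $L^2$ and independent standard real Brownian motions $\beta_j$. $\|\nabla Q^{1/2}\|_{\mathcal{L}_2^0}$ is the Hilbert--Schmidt norm, $\|\nabla Q^{1/2}\|_{\mathcal{L}_2^0}^2=\sum_j\|\nabla Q^{1/2}e_j\|_{L^2}^2$, and the notation $\mathrm{Tr}(\nabla Q\nabla)$ stands for $\|\nabla Q^{1/2}\|_{\mathcal{L}_2^0}^2$. *)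

theory Defs
  imports "HOL-Probability.Probability"
begin

text \<open>$L^2$ carries the real inner product $\mathrm{Re} \int u \bar v$ throughout: bases and operators
  below are those of the real Hilbert space.\<close>
definition square_integrable :: "(real^'d \<Rightarrow> complex) \<Rightarrow> bool"
  where "square_integrable f \<longleftrightarrow>
    f \<in> borel_measurable lborel \<and> integrable lborel (\<lambda>x. (norm (f x))\<^sup>2)"

lemma square_integrable_add:
  assumes "square_integrable f" "square_integrable g"
  shows "square_integrable (\<lambda>x. f x + g x)"
proof -
  have [measurable]: "f \<in> borel_measurable lborel" "g \<in> borel_measurable lborel"
    using assms by (auto simp: square_integrable_def)
  have "integrable lborel (\<lambda>x. 2 * (norm (f x))\<^sup>2 + 2 * (norm (g x))\<^sup>2)"
    using assms by (auto simp: square_integrable_def)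
  moreover have "(norm (f x + g x))\<^sup>2 \<le> 2 * (norm (f x))\<^sup>2 + 2 * (norm (g x))\<^sup>2" for x
  proof -
    have "(norm (f x + g x))\<^sup>2 \<le> (norm (f x) + norm (g x))\<^sup>2"
      by (intro power_mono norm_triangle_ineq) auto
    also have "\<dots> \<le> 2 * (norm (f x))\<^sup>2 + 2 * (norm (g x))\<^sup>2"
      using sum_squares_bound[of "norm (f x)" "norm (g x)"] by (simp add: power2_sum)
    finally show ?thesis .
  qed
  ultimately have "integrable lborel (\<lambda>x. (norm (f x + g x))\<^sup>2)"
    by (rule_tac Bochner_Integration.integrable_bound) (auto intro!: always_eventually)
  then show ?thesis
    by (simp add: square_integrable_def)
qed

lemma square_integrable_cmult:
  "square_integrable f \<Longrightarrow> square_integrable (\<lambda>x. c * f x)"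
  by (auto simp: square_integrable_def norm_mult power_mult_distrib)

lemma square_integrable_0: "square_integrable (\<lambda>x. 0)"
  by (simp add: square_integrable_def)

lemma square_integrable_uminus: "square_integrable f \<Longrightarrow> square_integrable (\<lambda>x. - f x)"
  by (auto simp: square_integrable_def)

lemma square_integrable_diff:
  "square_integrable f \<Longrightarrow> square_integrable g \<Longrightarrow> square_integrable (\<lambda>x. f x - g x)"
  using square_integrable_add[of f "\<lambda>x. - g x"] square_integrable_uminus[of g] by simp

lemma square_integrable_scaleR: "square_integrable f \<Longrightarrow> square_integrable (\<lambda>x. c *\<^sub>R f x)"
  by (auto simp: square_integrable_def power_mult_distrib)

lemma square_integrable_mult_cnj:
  assumes "square_integrable f" "square_integrable g"
  shows "integrable lborel (\<lambda>x. f x * cnj (g x))"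
proof -
  have [measurable]: "f \<in> borel_measurable lborel" "g \<in> borel_measurable lborel"
    using assms by (auto simp: square_integrable_def)
  have "integrable lborel (\<lambda>x. (norm (f x))\<^sup>2 + (norm (g x))\<^sup>2)"
    using assms by (auto simp: square_integrable_def)
  moreover have "norm (f x * cnj (g x)) \<le> norm ((norm (f x))\<^sup>2 + (norm (g x))\<^sup>2)" for x
  proof -
    have "0 \<le> norm (f x) * norm (g x)" by simp
    moreover have "2 * (norm (f x) * norm (g x)) \<le> (norm (f x))\<^sup>2 + (norm (g x))\<^sup>2"
      using sum_squares_bound[of "norm (f x)" "norm (g x)"] by (simp add: mult.assoc)
    ultimately have "norm (f x) * norm (g x) \<le> (norm (f x))\<^sup>2 + (norm (g x))\<^sup>2"
      by linarith
    then show ?thesis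
      by (simp add: norm_mult)
  qed
  moreover have "(\<lambda>x. f x * cnj (g x)) \<in> borel_measurable lborel"
    by (intro borel_measurable_times borel_measurable_continuous_on[where f = cnj])
       (auto intro!: continuous_intros)
  ultimately show ?thesis
    by (rule_tac Bochner_Integration.integrable_bound) (auto intro!: always_eventually)
qed

definition L2_rel :: "(real^'d \<Rightarrow> complex) \<Rightarrow> (real^'d \<Rightarrow> complex) \<Rightarrow> bool"
  where "L2_rel f g \<longleftrightarrow>
    square_integrable f \<and> square_integrable g \<and> (AE x in lborel. f x = g x)"

quotient_type 'd L2 = "(real^'d::finite) \<Rightarrow> complex" / partial: L2_rel
proof (rule part_equivpI)
  show "\<exists>f. L2_rel f f"
    by (rule exI[of _ "\<lambda>x. 0"]) (simp add: L2_rel_def square_integrable_0)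
  show "symp L2_rel"
    by (auto simp: L2_rel_def symp_def)
  show "transp L2_rel"
    by (auto simp: L2_rel_def transp_def)
qed

instantiation L2 :: (finite) real_vector
begin

lift_definition zero_L2 :: "'a L2" is "\<lambda>x. 0"
  by (simp add: L2_rel_def square_integrable_0)

lift_definition plus_L2 :: "'a L2 \<Rightarrow> 'a L2 \<Rightarrow> 'a L2" is "\<lambda>f g x. f x + g x"
  by (auto simp: L2_rel_def square_integrable_add)

lift_definition minus_L2 :: "'a L2 \<Rightarrow> 'a L2 \<Rightarrow> 'a L2" is "\<lambda>f g x. f x - g x"
  by (auto simp: L2_rel_def square_integrable_diff)

lift_definition uminus_L2 :: "'a L2 \<Rightarrow> 'a L2" is "\<lambda>f x. - f x"
  by (auto simp: L2_rel_def square_integrable_uminus)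

lift_definition scaleR_L2 :: "real \<Rightarrow> 'a L2 \<Rightarrow> 'a L2" is "\<lambda>c f x. c *\<^sub>R f x"
  by (auto simp: L2_rel_def square_integrable_scaleR)

instance
proof
  fix u v w :: "'a L2" and r s :: real
  show "u + v + w = u + (v + w)"
    by transfer (auto simp: L2_rel_def square_integrable_add add.assoc)
  show "u + v = v + u"
    by transfer (auto simp: L2_rel_def square_integrable_add add.commute)
  show "0 + u = u"
    by transfer (auto simp: L2_rel_def)
  show "- u + u = 0"
    by transfer (auto simp: L2_rel_def square_integrable_0)
  show "u - v = u + - v"
    by transfer (auto simp: L2_rel_def square_integrable_diff)
  show "r *\<^sub>R (u + v) = r *\<^sub>R u + r *\<^sub>R v"
    by transfer (auto simp: L2_rel_def square_integrable_add square_integrable_scaleR scaleR_add_right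
        simp flip: scaleR_conv_of_real)
  show "(r + s) *\<^sub>R u = r *\<^sub>R u + s *\<^sub>R u"
    by transfer (auto simp: L2_rel_def square_integrable_add square_integrable_scaleR scaleR_add_left
        simp flip: scaleR_conv_of_real)
  show "r *\<^sub>R s *\<^sub>R u = (r * s) *\<^sub>R u"
    by transfer (auto simp: L2_rel_def square_integrable_scaleR)
  show "1 *\<^sub>R u = u"
    by transfer (auto simp: L2_rel_def)
qed

end

instantiation L2 :: (finite) real_inner
begin

lift_definition inner_L2 :: "'a L2 \<Rightarrow> 'a L2 \<Rightarrow> real"
  is "\<lambda>f g. Re (\<integral>x. f x * cnj (g x) \<partial>lborel)"
proof -
  fix f f' g g' :: "real^'a \<Rightarrow> complex"
  assume "L2_rel f f'" "L2_rel g g'"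
  then have sq: "square_integrable f" "square_integrable f'"
      "square_integrable g" "square_integrable g'"
    and ae: "AE x in lborel. f x = f' x" "AE x in lborel. g x = g' x"
    by (auto simp: L2_rel_def)
  have "(\<integral>x. f x * cnj (g x) \<partial>lborel) = (\<integral>x. f' x * cnj (g' x) \<partial>lborel)"
    using ae square_integrable_mult_cnj[OF sq(1,3)] square_integrable_mult_cnj[OF sq(2,4)]
    by (intro integral_cong_AE) auto
  then show "Re (\<integral>x. f x * cnj (g x) \<partial>lborel) = Re (\<integral>x. f' x * cnj (g' x) \<partial>lborel)"
    by simp
qed

definition norm_L2 :: "'a L2 \<Rightarrow> real"
  where "norm_L2 u = sqrt (u \<bullet> u)"

definition sgn_L2 :: "'a L2 \<Rightarrow> 'a L2"
  where "sgn_L2 u = u /\<^sub>R norm u"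

definition dist_L2 :: "'a L2 \<Rightarrow> 'a L2 \<Rightarrow> real"
  where "dist_L2 u v = norm (u - v)"

definition uniformity_L2 :: "('a L2 \<times> 'a L2) filter"
  where "uniformity_L2 = (INF e\<in>{0<..}. principal {(u, v). dist u v < e})"

definition open_L2 :: "'a L2 set \<Rightarrow> bool"
  where "open_L2 U \<longleftrightarrow> (\<forall>u\<in>U. eventually (\<lambda>(u', v). u' = u \<longrightarrow> v \<in> U) uniformity)"

instance
proof
  fix u v w :: "'a L2" and r :: real and U :: "'a L2 set"
  show "dist u v = norm (u - v)" by (rule dist_L2_def)
  show "sgn u = u /\<^sub>R norm u" by (rule sgn_L2_def)
  show "uniformity = (INF e\<in>{0<..}. principal {(u, v :: 'a L2). dist u v < e})"
    by (rule uniformity_L2_def)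
  show "open U \<longleftrightarrow> (\<forall>u\<in>U. eventually (\<lambda>(u', v). u' = u \<longrightarrow> v \<in> U) uniformity)"
    by (rule open_L2_def)
  show "u \<bullet> v = v \<bullet> u"
  proof transfer
    fix f g :: "real^'a \<Rightarrow> complex"
    have "(\<integral>x. g x * cnj (f x) \<partial>lborel) = (\<integral>x. cnj (f x * cnj (g x)) \<partial>lborel)"
      by (simp add: mult.commute)
    also have "\<dots> = cnj (\<integral>x. f x * cnj (g x) \<partial>lborel)"
      by (rule Bochner_Integration.integral_cnj)
    finally show "Re (\<integral>x. f x * cnj (g x) \<partial>lborel) = Re (\<integral>x. g x * cnj (f x) \<partial>lborel)"
      by simp
  qed
  show "(u + v) \<bullet> w = u \<bullet> w + v \<bullet> w"
  proof transfer
    fix f g h :: "real^'a \<Rightarrow> complex"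
    assume "L2_rel f f" "L2_rel g g" "L2_rel h h"
    then show "Re (\<integral>x. (f x + g x) * cnj (h x) \<partial>lborel)
      = Re (\<integral>x. f x * cnj (h x) \<partial>lborel) + Re (\<integral>x. g x * cnj (h x) \<partial>lborel)"
      by (simp add: L2_rel_def distrib_right square_integrable_mult_cnj)
  qed
  show "(r *\<^sub>R u) \<bullet> v = r * (u \<bullet> v)"
    by transfer simp
  have sq: "Re (\<integral>x. f x * cnj (f x) \<partial>lborel) = (\<integral>x. (norm (f x))\<^sup>2 \<partial>lborel)"
    for f :: "real^'a \<Rightarrow> complex"
    by (simp flip: complex_norm_square of_real_power)
  show "0 \<le> u \<bullet> u"
    by transfer (simp add: sq)
  show "u \<bullet> u = 0 \<longleftrightarrow> u = 0"
  proof transfer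
    fix f :: "real^'a \<Rightarrow> complex"
    assume "L2_rel f f"
    then have f: "square_integrable f" by (simp add: L2_rel_def)
    have "(\<integral>x. (norm (f x))\<^sup>2 \<partial>lborel) = 0 \<longleftrightarrow> (AE x in lborel. (norm (f x))\<^sup>2 = 0)"
      using f by (intro integral_nonneg_eq_0_iff_AE) (auto simp: square_integrable_def)
    then show "Re (\<integral>x. f x * cnj (f x) \<partial>lborel) = 0 \<longleftrightarrow> L2_rel f (\<lambda>x. 0)"
      using f by (simp add: sq L2_rel_def square_integrable_0)
  qed
  show "norm u = sqrt (u \<bullet> u)" by (rule norm_L2_def)
qed

end

lift_definition mulC :: "complex \<Rightarrow> 'd::finite L2 \<Rightarrow> 'd L2" (infixr "*\<^sub>C" 75) is "\<lambda>c f x. c * f x"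
  by (auto simp: L2_rel_def square_integrable_cmult)

text \<open>A fixed measurable representative; integrals of it do not depend on the choice.\<close>
abbreviation fn :: "'d::finite L2 \<Rightarrow> real^'d \<Rightarrow> complex"
  where "fn u \<equiv> rep_L2 u"

definition pd :: "'d \<Rightarrow> (real^'d::finite \<Rightarrow> real) \<Rightarrow> real^'d \<Rightarrow> real"
  where "pd i \<phi> x = frechet_derivative \<phi> (at x) (axis i 1)"

text \<open>Smooth means that all iterated partial derivatives exist and are Frechet differentiable.\<close>
definition smooth :: "(real^'d::finite \<Rightarrow> real) \<Rightarrow> bool"
  where "smooth \<phi> \<longleftrightarrow> (\<forall>is x. foldr pd is \<phi> differentiable (at x))"

definition test_function :: "(real^'d::finite \<Rightarrow> real) \<Rightarrow> bool"
  where "test_function \<phi> \<longleftrightarrow> smooth \<phi> \<and> (\<exists>K. compact K \<and> (\<forall>x. x \<notin> K \<longrightarrow> \<phi> x = 0))"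

definition laplacian :: "(real^'d::finite \<Rightarrow> real) \<Rightarrow> real^'d \<Rightarrow> real"
  where "laplacian \<phi> x = (\<Sum>i\<in>UNIV. pd i (pd i \<phi>) x)"

definition has_weak_pd :: "'d::finite \<Rightarrow> 'd L2 \<Rightarrow> 'd L2 \<Rightarrow> bool"
  where "has_weak_pd i u v \<longleftrightarrow> (\<forall>\<phi>. test_function \<phi> \<longrightarrow>
    (\<integral>x. pd i \<phi> x *\<^sub>R fn u x \<partial>lborel) = - (\<integral>x. \<phi> x *\<^sub>R fn v x \<partial>lborel))"

definition has_weak_laplacian :: "'d::finite L2 \<Rightarrow> 'd L2 \<Rightarrow> bool"
  where "has_weak_laplacian u v \<longleftrightarrow> (\<forall>\<phi>. test_function \<phi> \<longrightarrow>
    (\<integral>x. laplacian \<phi> x *\<^sub>R fn u x \<partial>lborel) = (\<integral>x. \<phi> x *\<^sub>R fn v x \<partial>lborel))"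

definition H1 :: "'d::finite L2 set"
  where "H1 = {u. \<forall>i. \<exists>v. has_weak_pd i u v}"

definition grad :: "'d::finite L2 \<Rightarrow> real^'d \<Rightarrow> complex^'d"
  where "grad u x = (\<chi> i. fn (THE v. has_weak_pd i u v) x)"

text \<open>$\int |\nabla u|^2$, which is infinite if $u$ is not in $H^1$.\<close>
definition grad_normsq :: "'d::finite L2 \<Rightarrow> ennreal"
  where "grad_normsq u =
    (if u \<in> H1 then \<integral>\<^sup>+x. ennreal ((norm (grad u x))\<^sup>2) \<partial>lborel else \<infinity>)"

definition energy :: "'d::finite L2 \<Rightarrow> ennreal"
  where "energy u = grad_normsq u / 2"

definition unitary :: "('d::finite L2 \<Rightarrow> 'd L2) \<Rightarrow> bool"
  where "unitary U \<longleftrightarrow> (\<forall>u v. U (u + v) = U u + U v) \<and> (\<forall>c u. U (c *\<^sub>C u) = c *\<^sub>C U u) \<and>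
    (\<forall>u. norm (U u) = norm u) \<and> surj U"

definition unitary_group :: "(real \<Rightarrow> 'd::finite L2 \<Rightarrow> 'd L2) \<Rightarrow> bool"
  where "unitary_group S \<longleftrightarrow> (\<forall>t. unitary (S t)) \<and> S 0 = id \<and>
    (\<forall>s t. S (s + t) = S s \<circ> S t) \<and> (\<forall>u. continuous_on UNIV (\<lambda>t. S t u))"

text \<open>Unbounded operators are given by their graphs.\<close>
definition generates :: "('d::finite L2 \<Rightarrow> 'd L2 \<Rightarrow> bool) \<Rightarrow> (real \<Rightarrow> 'd L2 \<Rightarrow> 'd L2) \<Rightarrow> bool"
  where "generates A S \<longleftrightarrow> (\<forall>u v. A u v \<longleftrightarrow> ((\<lambda>t. (S t u - u) /\<^sub>R t) \<longlongrightarrow> v) (at 0))"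

text \<open>The operator $-\mathrm{i}\Delta$ with its maximal domain
  $\{u \in L^2.\ \Delta u \in L^2\} = H^2$, $\Delta u$ being taken in the sense of distributions.\<close>
definition minus_i_Laplacian :: "'d::finite L2 \<Rightarrow> 'd L2 \<Rightarrow> bool"
  where "minus_i_Laplacian u v \<longleftrightarrow> (\<exists>w. has_weak_laplacian u w \<and> v = (- \<i>) *\<^sub>C w)"

definition schroedinger_group :: "(real \<Rightarrow> 'd::finite L2 \<Rightarrow> 'd L2) \<Rightarrow> bool"
  where "schroedinger_group S \<longleftrightarrow> unitary_group S \<and> generates minus_i_Laplacian S"

definition orthonormal_basis :: "(nat \<Rightarrow> 'h::real_inner) \<Rightarrow> bool"
  where "orthonormal_basis e \<longleftrightarrow> (\<forall>i j. e i \<bullet> e j = (if i = j then 1 else 0)) \<and>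
    closure (span (range e)) = UNIV"

definition nonneg_selfadjoint :: "('h::real_inner \<Rightarrow> 'h) \<Rightarrow> bool"
  where "nonneg_selfadjoint T \<longleftrightarrow> bounded_linear T \<and>
    (\<forall>u v. T u \<bullet> v = u \<bullet> T v) \<and> (\<forall>u. 0 \<le> T u \<bullet> u)"

text \<open>Nuclear representation; equivalent to summability of the singular values.\<close>
definition trace_class :: "('h::real_inner \<Rightarrow> 'h) \<Rightarrow> bool"
  where "trace_class T \<longleftrightarrow> (\<exists>a b :: nat \<Rightarrow> 'h. summable (\<lambda>j. norm (a j) * norm (b j)) \<and>
    (\<forall>u. (\<lambda>j. (a j \<bullet> u) *\<^sub>R b j) sums T u))"

definition is_sqrt_op :: "('h::real_inner \<Rightarrow> 'h) \<Rightarrow> ('h \<Rightarrow> 'h) \<Rightarrow> bool"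
  where "is_sqrt_op R Q \<longleftrightarrow> nonneg_selfadjoint R \<and> R \<circ> R = Q"

text \<open>$\|\nabla R\|^2$ in the Hilbert--Schmidt norm, computed in the basis $e$.\<close>
definition grad_HS_normsq :: "(nat \<Rightarrow> 'd::finite L2) \<Rightarrow> ('d L2 \<Rightarrow> 'd L2) \<Rightarrow> ennreal"
  where "grad_HS_normsq e R = (\<Sum>j. grad_normsq (R (e j)))"

text \<open>The time set is $[0,\infty)$; values at negative times are irrelevant.\<close>
definition normal_filtration :: "'w measure \<Rightarrow> (real \<Rightarrow> 'w measure) \<Rightarrow> bool"
  where "normal_filtration P F \<longleftrightarrow>
    (\<forall>t\<ge>0. subalgebra P (F t)) \<and>
    (\<forall>s t. 0 \<le> s \<and> s \<le> t \<longrightarrow> sets (F s) \<subseteq> sets (F t)) \<and>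
    null_sets P \<subseteq> sets (F 0) \<and>
    (\<forall>t\<ge>0. sets (F t) = (\<Inter>s\<in>{t<..}. sets (F s)))"

text \<open>The normal law on the line with the given mean and variance, degenerate if the variance is 0.\<close>
definition normal_law :: "real \<Rightarrow> real \<Rightarrow> real measure"
  where "normal_law m v = (if v = 0 then return borel m else density lborel (normal_density m (sqrt v)))"

text \<open>$X$ has the centred Gaussian law $N(0,C)$ on a Hilbert space.\<close>
definition centred_gaussian :: "'w measure \<Rightarrow> ('w \<Rightarrow> 'h::real_inner) \<Rightarrow> ('h \<Rightarrow> 'h) \<Rightarrow> bool"
  where "centred_gaussian P X C \<longleftrightarrow> X \<in> borel_measurable P \<and>
    (\<forall>h. distr P borel (\<lambda>\<omega>. X \<omega> \<bullet> h) = normal_law 0 (C h \<bullet> h))"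

text \<open>A $Q$-Wiener process with respect to the filtration $F$. On a separable Hilbert space
  with $Q$ of trace class, this is the law of $\sum_j \beta_j(t) Q^{1/2} e_j$ for independent
  real Brownian motions $\beta_j$.\<close>
definition Q_wiener_process ::
    "'w measure \<Rightarrow> (real \<Rightarrow> 'w measure) \<Rightarrow> ('h::real_inner \<Rightarrow> 'h) \<Rightarrow> (real \<Rightarrow> 'w \<Rightarrow> 'h) \<Rightarrow> bool"
  where "Q_wiener_process P F Q W \<longleftrightarrow>
    (AE \<omega> in P. W 0 \<omega> = 0) \<and>
    (AE \<omega> in P. continuous_on {0..} (\<lambda>t. W t \<omega>)) \<and>
    (\<forall>t\<ge>0. W t \<in> borel_measurable (F t)) \<and>
    (\<forall>s t. 0 \<le> s \<and> s < t \<longrightarrow>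
      prob_space.indep_set P (sets (F s))
        {(\<lambda>\<omega>. W t \<omega> - W s \<omega>) -` B \<inter> space P | B. B \<in> sets borel} \<and>
      centred_gaussian P (\<lambda>\<omega>. W t \<omega> - W s \<omega>) (\<lambda>h. (t - s) *\<^sub>R Q h))"

primrec exp_integrator ::
    "(real \<Rightarrow> 'd::finite L2 \<Rightarrow> 'd L2) \<Rightarrow> real \<Rightarrow> (real \<Rightarrow> 'w \<Rightarrow> 'd L2) \<Rightarrow> ('w \<Rightarrow> 'd L2) \<Rightarrow>
      nat \<Rightarrow> 'w \<Rightarrow> 'd L2"
  where
    "exp_integrator S k W u0 0 = u0"
  | "exp_integrator S k W u0 (Suc n) = (\<lambda>\<omega>.
      S k (exp_integrator S k W u0 n \<omega>)
        - \<i> *\<^sub>C S k (W (real (Suc n) * k) \<omega> - W (real n * k) \<omega>))"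

end

theory Submission
  imports Defs
begin

text \<open>
  Write \<open>N(u)\<close> for \<open>\<integral>|\<nabla>u|\<^sup>2\<close>, so that the energy is \<open>N(u)/2\<close>, and \<open>R\<close> for the square root of \<open>Q\<close>.
  The group \<open>S(t)\<close> and multiplication by \<open>\<i>\<close> preserve \<open>N\<close>. Hence one step of the scheme, which is
  \<open>S(k)(u - \<i> \<Delta>W)\<close>, turns \<open>N(u)\<close> into \<open>N(u - \<i> \<Delta>W)\<close>. The increment \<open>\<Delta>W\<close> is centred and independent
  of \<open>u\<close>, so the cross term vanishes in expectation, and \<open>E N(\<Delta>W)\<close> is \<open>k\<close> times the squared
  Hilbert-Schmidt norm of \<open>\<nabla>R\<close>.

  All of this would be immediate if \<open>N\<close> were a bounded quadratic form. The proof therefore writes \<open>N\<close> as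
  the limit of an increasing sequence of such forms. Let \<open>D\<close> be the forward difference quotient in a
  coordinate direction with step \<open>2\<^sup>-\<^sup>n\<close>. The quotient with step \<open>2h\<close> is an average of two translates of
  the quotient with step \<open>h\<close>, so the norms of the dyadic quotients of \<open>u\<close> increase with \<open>n\<close>. Their
  supremum is the norm of the weak derivative if there is one, and is infinite otherwise
  (\<open>grad_normsq_eq_SUP\<close>). The first part rests on duality against test functions, which are dense in
  \<open>L\<^sup>2\<close> because they separate its points (\<open>test_vectors_separate\<close>). The second part takes a weak limit
  of the bounded sequence of quotients (\<open>bounded_sequence_weak_limit\<close>). Both use that \<open>L\<^sup>2\<close> is complete.

  The Schroedinger group enters only as a unitary group that commutes with translations
  (\<open>schroedinger_group_translate\<close>): the Laplacian commutes with translations, and a unitary group is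
  determined by its generator. Then \<open>D S(t) u = S(t) D u\<close> has the norm of \<open>D u\<close>.

  For a fixed quotient \<open>D\<close>, expanding in the basis \<open>e\<close> turns \<open>E |D(u - \<i> \<Delta>W)|\<^sup>2\<close> into a series of
  second moments of sums of two independent real random variables, and a second use of Parseval's
  identity gives \<open>k \<Sum>\<^sub>l |D R e\<^sub>l|\<^sup>2\<close> for the noise (\<open>expectation_norm_diff_quot_step\<close>). All terms are
  nonnegative, so the series can be rearranged, and monotone convergence in \<open>n\<close> yields the identity for
  \<open>N\<close> itself (\<open>expectation_grad_normsq_step\<close>).
\<close>

section \<open>The space L2 as a Hilbert space of functions\<close>

lemma fn_abs_L2:
  assumes "square_integrable f" shows "AE x in lborel. fn (abs_L2 f) x = f x"
  using Quotient3_rep_abs[OF Quotient3_L2, of f] assms by (auto simp: L2_rel_def)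

lemma square_integrable_fn [simp]: "square_integrable (fn u)"
  using Quotient3_rep_reflp[OF Quotient3_L2, of u] by (auto simp: L2_rel_def)

lemma abs_L2_fn [simp]: "abs_L2 (fn u) = u"
  by (rule Quotient3_abs_rep[OF Quotient3_L2])

lemma fn_measurable [measurable]: "fn u \<in> borel_measurable lborel"
  using square_integrable_fn[of u] unfolding square_integrable_def by blast

lemma inner_fn: "u \<bullet> v = Re (\<integral>x. fn u x * cnj (fn v x) \<partial>lborel)"
  using inner_L2.abs_eq[of "fn u" "fn v"] by (simp add: L2_rel_def)

lemma norm_fn: "(norm u)\<^sup>2 = (\<integral>x. (norm (fn u x))\<^sup>2 \<partial>lborel)"
  unfolding power2_norm_eq_inner[of u] inner_fn
  by (simp flip: complex_norm_square of_real_power)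

text \<open>The extended form is the one to which the convergence theorems for nonnegative integrands apply.\<close>
lemma nn_norm_fn: "ennreal ((norm u)\<^sup>2) = (\<integral>\<^sup>+x. ennreal ((norm (fn u x))\<^sup>2) \<partial>lborel)"
  unfolding norm_fn using square_integrable_fn[of u]
  by (subst nn_integral_eq_integral) (auto simp: square_integrable_def)

lemma fn_diff: "AE x in lborel. fn (u - v) x = fn u x - fn v x"
proof -
  have "u - v = abs_L2 (\<lambda>x. fn u x - fn v x)"
    using minus_L2.abs_eq[of "fn u" "fn v"] by (simp add: L2_rel_def)
  then show ?thesis using fn_abs_L2[OF square_integrable_diff[of "fn u" "fn v"]] by simp
qed

lemma nn_norm_abs_L2: 
  assumes "square_integrable f"
  shows "ennreal ((norm (abs_L2 f))\<^sup>2) = (\<integral>\<^sup>+x. ennreal ((norm (f x))\<^sup>2) \<partial>lborel)"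
  unfolding nn_norm_fn using fn_abs_L2[OF assms]
  by (intro nn_integral_cong_AE) auto

lemma mulC_diff: "c *\<^sub>C (u - v) = c *\<^sub>C u - c *\<^sub>C v"
  by transfer (auto simp: L2_rel_def square_integrable_cmult square_integrable_diff right_diff_distrib)

lemma mulC_scaleR: "c *\<^sub>C (r *\<^sub>R u) = r *\<^sub>R (c *\<^sub>C u)"
  by transfer
    (simp only: L2_rel_def square_integrable_cmult square_integrable_scaleR mult_scaleR_right,
     simp add: square_integrable_scaleR square_integrable_cmult)

lemma mulC_adjoint: "(c *\<^sub>C u) \<bullet> v = u \<bullet> (cnj c *\<^sub>C v)"
  by transfer (simp add: mult.assoc mult.left_commute)

section \<open>Translations\<close>

lemma shift_measurable: "(\<lambda>x. x + h) \<in> lborel \<rightarrow>\<^sub>M (lborel :: (real^'d::finite) measure)"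
  by simp

lemma lborel_distr_shift: "distr lborel lborel (\<lambda>x. x + h) = (lborel :: (real^'d::finite) measure)"
  using lborel_distr_plus[of h] by (simp add: add.commute cong: distr_cong)

lemma AE_shift:
  assumes "AE x in lborel. P (x :: real^'d::finite)"
  shows "AE x in lborel. P (x + h)"
proof -
  have "AE x in distr lborel lborel (\<lambda>x. x + h). P x"
    using assms unfolding lborel_distr_shift .
  then show ?thesis by (rule AE_distrD[rotated]) simp
qed

lemma integrable_shift:
  fixes f :: "real^'d::finite \<Rightarrow> 'b::{banach, second_countable_topology}"
  assumes "integrable lborel f" 
  shows "integrable lborel (\<lambda>x. f (x + h))"
proof -
  have "integrable (distr lborel lborel (\<lambda>x. x + h)) f"
    using assms by (simp add: lborel_distr_shift)
  then show ?thesis by (rule integrable_distr[rotated]) simp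
qed

lemma integral_shift:
  fixes f :: "real^'d::finite \<Rightarrow> 'b::{banach, second_countable_topology}"
  assumes "f \<in> borel_measurable lborel"
  shows "(\<integral>x. f (x + h) \<partial>lborel) = (\<integral>x. f x \<partial>lborel)"
proof -
  have "(\<integral>x. f x \<partial>distr lborel lborel (\<lambda>x. x + h)) = (\<integral>x. f (x + h) \<partial>lborel)"
    by (rule integral_distr) (use assms in auto)
  then show ?thesis by (simp add: lborel_distr_shift)
qed

lemma square_integrable_shift:
  assumes "square_integrable f" shows "square_integrable (\<lambda>x. f (x + h))"
  using assms integrable_shift[of "\<lambda>x. (norm (f x))\<^sup>2" h]
  unfolding square_integrable_def by (auto intro: measurable_compose[OF shift_measurable])

lift_definition translate :: "real^'d::finite \<Rightarrow> 'd L2 \<Rightarrow> 'd L2" is "\<lambda>h f x. f (x + h)"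
  unfolding L2_rel_def
  by (intro conjI; elim conjE) (rule square_integrable_shift AE_shift, assumption)+

lemma translate_abs_L2:
  "square_integrable f \<Longrightarrow> translate h (abs_L2 f) = abs_L2 (\<lambda>x. f (x + h))"
  by (rule translate.abs_eq) (simp add: L2_rel_def)

lemma translate_translate: "translate h (translate h' u) = translate (h + h') u"
  by transfer (auto simp: L2_rel_def square_integrable_shift add.assoc)

lemma translate_0 [simp]: "translate 0 u = u"
  by transfer (auto simp: L2_rel_def)

lemma translate_add: "translate h (u + v) = translate h u + translate h v"
  by transfer (auto simp: L2_rel_def square_integrable_shift square_integrable_add)

lemma translate_scaleR: "translate h (r *\<^sub>R u) = r *\<^sub>R translate h u"
  by transfer (auto simp: L2_rel_def square_integrable_shift square_integrable_scaleR)

lemma translate_diff: "translate h (u - v) = translate h u - translate h v"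
  by transfer (auto simp: L2_rel_def square_integrable_shift square_integrable_diff)

lemma translate_mulC: "translate h (c *\<^sub>C u) = c *\<^sub>C translate h u"
  by transfer (auto simp: L2_rel_def square_integrable_shift square_integrable_cmult)

lemma inner_translate: "translate h u \<bullet> translate h v = u \<bullet> v"
proof transfer
  fix h and f g :: "real^'a \<Rightarrow> complex"
  assume "L2_rel f f" "L2_rel g g"
  then have "(\<lambda>x. f x * cnj (g x)) \<in> borel_measurable lborel"
    unfolding L2_rel_def by (intro borel_measurable_integrable square_integrable_mult_cnj) auto
  from integral_shift[OF this, of h]
  show "Re (\<integral>x. f (x + h) * cnj (g (x + h)) \<partial>lborel) = Re (\<integral>x. f x * cnj (g x) \<partial>lborel)"
    by simp
qed

lemma norm_translate [simp]: "norm (translate h u) = norm u"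
  by (simp add: norm_eq_sqrt_inner inner_translate)

lemma translate_adjoint: "translate h u \<bullet> v = u \<bullet> translate (- h) v"
  using inner_translate[of h u "translate (-h) v"] by (simp add: translate_translate)


section \<open>Completeness and weak limits\<close>

text \<open>Riesz representation: a maximising sequence of \<open>2 l(x) - |x|\<^sup>2\<close> on \<open>T\<close> is Cauchy by the
  parallelogram law, and the first variation at its limit gives the representation. That the
  representative lies in the closure of \<open>T\<close> makes the density criterion below a corollary.\<close>
lemma riesz_on_subspace:
  fixes l :: "'a::{real_inner, complete_space} \<Rightarrow> real"
  assumes T: "subspace T"
    and add: "\<And>x y. x \<in> T \<Longrightarrow> y \<in> T \<Longrightarrow> l (x + y) = l x + l y"
    and scale: "\<And>c x. x \<in> T \<Longrightarrow> l (c *\<^sub>R x) = c * l x"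
    and bound: "\<And>x. x \<in> T \<Longrightarrow> \<bar>l x\<bar> \<le> M * norm x"
  shows "\<exists>v\<in>closure T. \<forall>x\<in>T. v \<bullet> x = l x"
proof -
  define J where "J x = 2 * l x - x \<bullet> x" for x
  have J_le: "J x \<le> M\<^sup>2" if "x \<in> T" for x
  proof -
    have "2 * l x \<le> 2 * (M * norm x)" using bound[OF that] by linarith
    also have "\<dots> \<le> M\<^sup>2 + x \<bullet> x"
      using sum_squares_bound[of M "norm x"] by (simp add: power2_norm_eq_inner mult.assoc)
    finally show ?thesis by (simp add: J_def)
  qed
  define s where "s = (SUP x\<in>T. J x)"
  have bdd: "bdd_above (J ` T)" using J_le by (intro bdd_aboveI[of _ "M\<^sup>2"]) auto
  have ne: "T \<noteq> {}" using subspace_0[OF T] by auto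
  have J_le_s: "J x \<le> s" if "x \<in> T" for x
    unfolding s_def using that bdd by (rule cSUP_upper)
  have "\<exists>x\<in>T. s - inverse (real (Suc n)) < J x" for n
    using less_cSUP_iff[OF ne bdd, of "s - inverse (real (Suc n))"] by (simp add: s_def)
  then obtain X where X: "\<And>n. X n \<in> T" "\<And>n. s - inverse (real (Suc n)) < J (X n)"
    by metis
  \<comment> \<open>The value of \<open>J\<close> at the midpoint exceeds the mean of its values by \<open>|x - y|\<^sup>2 / 4\<close>.\<close>
  have par: "(norm (x - y))\<^sup>2 \<le> 2 * (2 * s - J x - J y)" if "x \<in> T" "y \<in> T" for x y
  proof -
    have m: "(1/2) *\<^sub>R (x + y) \<in> T" using that T by (simp add: subspace_add subspace_scale)
    have xy: "x + y \<in> T" using that T by (simp add: subspace_add)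
    have "J ((1/2) *\<^sub>R (x + y)) = l x + l y - (x + y) \<bullet> (x + y) / 4"
      by (simp add: J_def scale[OF xy] add[OF that])
    moreover have "(norm (x - y))\<^sup>2 = 2 * (x \<bullet> x) + 2 * (y \<bullet> y) - (x + y) \<bullet> (x + y)"
      by (simp add: power2_norm_eq_inner inner_diff inner_add inner_commute algebra_simps)
    ultimately show ?thesis using J_le_s[OF m] by (simp add: J_def)
  qed
  have combine: "a < e2"
    if "a \<le> 2 * (2 * s - p - q)" "s - i < p" "s - j < q" "i \<le> c" "j \<le> c" "c < e2 / 4"
    for a p q i j c e2 :: real
    using that by argo
  have "Cauchy X"
  proof (rule metric_CauchyI)
    fix e :: real assume "e > 0"
    then obtain N where N: "inverse (real (Suc N)) < e\<^sup>2 / 4"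
      using reals_Archimedean[of "e\<^sup>2 / 4"] by auto
    have "dist (X m) (X n) < e" if "m \<ge> N" "n \<ge> N" for m n
    proof -
      have inv: "inverse (real (Suc j)) \<le> inverse (real (Suc N))" if "j \<ge> N" for j
        using that by (simp add: field_simps)
      have "(norm (X m - X n))\<^sup>2 < e\<^sup>2"
        by (rule combine[OF par[OF X(1) X(1)] X(2) X(2) inv[OF that(1)] inv[OF that(2)] N])
      then show ?thesis using \<open>e > 0\<close> by (simp add: dist_norm power2_less_imp_less)
    qed
    then show "\<exists>N. \<forall>m\<ge>N. \<forall>n\<ge>N. dist (X m) (X n) < e" by blast
  qed
  then obtain v where v: "X \<longlonglongrightarrow> v" using Cauchy_convergent convergent_def by blast
  have "v \<in> closure T" using X(1) v closure_sequential by blast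
  moreover have "v \<bullet> y = l y" if y: "y \<in> T" for y
  proof (cases "y = 0")
    case True
    then show ?thesis using scale[OF y, of 0] by simp
  next
    case False
    define d where "d = l y - v \<bullet> y"
    \<comment> \<open>The step from \<open>v\<close> in the direction \<open>y\<close> that maximises \<open>J\<close>.\<close>
    define t where "t = d / (y \<bullet> y)"
    have lim: "(\<lambda>n. - inverse (real (Suc n)) + (2 * t * (l y - X n \<bullet> y) - t\<^sup>2 * (y \<bullet> y)))
        \<longlonglongrightarrow> - 0 + (2 * t * (l y - v \<bullet> y) - t\<^sup>2 * (y \<bullet> y))"
      by (intro tendsto_intros v LIMSEQ_inverse_real_of_nat)
    have "- inverse (real (Suc n)) + (2 * t * (l y - X n \<bullet> y) - t\<^sup>2 * (y \<bullet> y)) \<le> 0" for n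
    proof -
      have ty: "t *\<^sub>R y \<in> T" using y T by (simp add: subspace_scale)
      have "J (X n + t *\<^sub>R y) = J (X n) + (2 * t * (l y - X n \<bullet> y) - t\<^sup>2 * (y \<bullet> y))"
        by (simp add: J_def add[OF X(1) ty] scale[OF y] inner_add inner_commute
            power2_eq_square algebra_simps)
      moreover have "J (X n + t *\<^sub>R y) \<le> s"
        using J_le_s X(1) ty T by (simp add: subspace_add)
      ultimately show ?thesis using X(2)[of n] by linarith
    qed
    then have "- 0 + (2 * t * (l y - v \<bullet> y) - t\<^sup>2 * (y \<bullet> y)) \<le> 0"
      by (intro LIMSEQ_le_const2[OF lim]) blast
    then have "2 * t * d - t\<^sup>2 * (y \<bullet> y) \<le> 0" by (simp add: d_def)
    moreover have "2 * t * d - t\<^sup>2 * (y \<bullet> y) = d\<^sup>2 / (y \<bullet> y)"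
      using False by (simp add: t_def power2_eq_square field_simps)
    ultimately have "d\<^sup>2 / (y \<bullet> y) \<le> 0" by simp
    moreover have "d\<^sup>2 / (y \<bullet> y) \<ge> 0" by simp
    ultimately have "d\<^sup>2 / (y \<bullet> y) = 0" by linarith
    then have "d = 0" using False by simp
    then show ?thesis by (simp add: d_def)
  qed
  ultimately show ?thesis by blast
qed

text \<open>The functional \<open>w \<bullet> _\<close> on \<open>T\<close> is represented by some \<open>v\<close> in the closure of \<open>T\<close>; then
  \<open>v - w\<close> is orthogonal to \<open>T\<close> and hence zero.\<close>
lemma closure_eq_UNIV_if_separating:
  fixes T :: "'a::{real_inner, complete_space} set"
  assumes T: "subspace T" and sep: "\<And>v. (\<And>x. x \<in> T \<Longrightarrow> v \<bullet> x = 0) \<Longrightarrow> v = 0"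
  shows "closure T = UNIV"
proof -
  have "w \<in> closure T" for w
  proof -
    obtain v where v: "v \<in> closure T" "\<And>x. x \<in> T \<Longrightarrow> v \<bullet> x = w \<bullet> x"
      using riesz_on_subspace[OF T, of "\<lambda>x. w \<bullet> x" "norm w"] Cauchy_Schwarz_ineq2[of w]
      by (auto simp: inner_add)
    have "v - w = 0" by (rule sep) (simp add: v inner_diff)
    then show ?thesis using v(1) by simp
  qed
  then show ?thesis by blast
qed

text \<open>A substitute for weak sequential compactness that avoids subsequences: the test vectors against which
  the sequence converges form a subspace, and the limit functional on it is represented by Riesz.\<close>
lemma bounded_sequence_weak_limit:
  fixes X :: "nat \<Rightarrow> 'a::{real_inner, complete_space}"
  assumes "\<And>n. norm (X n) \<le> M"
  obtains v where "\<And>w c. (\<lambda>n. X n \<bullet> w) \<longlonglongrightarrow> c \<Longrightarrow> v \<bullet> w = c"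
proof -
  define T where "T = {w. convergent (\<lambda>n. X n \<bullet> w)}"
  define l where "l w = lim (\<lambda>n. X n \<bullet> w)" for w
  have lim: "(\<lambda>n. X n \<bullet> w) \<longlonglongrightarrow> l w" if "w \<in> T" for w
    using that by (simp add: T_def l_def convergent_LIMSEQ_iff)
  have add: "(\<lambda>n. X n \<bullet> (x + y)) \<longlonglongrightarrow> l x + l y" if "x \<in> T" "y \<in> T" for x y
    unfolding inner_add_right by (intro tendsto_add lim that)
  have scale: "(\<lambda>n. X n \<bullet> (c *\<^sub>R x)) \<longlonglongrightarrow> c * l x" if "x \<in> T" for c x
    unfolding inner_scaleR_right by (intro tendsto_mult tendsto_const lim that)
  have "subspace T"
    unfolding subspace_def
  proof (intro conjI ballI allI)
    show "0 \<in> T" by (simp add: T_def convergent_const)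
    show "x + y \<in> T" if "x \<in> T" "y \<in> T" for x y
      using add[OF that] unfolding T_def convergent_def by blast
    show "c *\<^sub>R x \<in> T" if "x \<in> T" for c x
      using scale[OF that] unfolding T_def convergent_def by blast
  qed
  moreover have "\<bar>l x\<bar> \<le> M * norm x" if "x \<in> T" for x
  proof (rule LIMSEQ_le_const2)
    show "(\<lambda>n. \<bar>X n \<bullet> x\<bar>) \<longlonglongrightarrow> \<bar>l x\<bar>" by (intro tendsto_rabs lim that)
    have "\<bar>X n \<bullet> x\<bar> \<le> M * norm x" for n
      using Cauchy_Schwarz_ineq2[of "X n" x] mult_right_mono[OF assms norm_ge_zero, of n x]
      by linarith
    then show "\<exists>N. \<forall>n\<ge>N. \<bar>X n \<bullet> x\<bar> \<le> M * norm x" by blast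
  qed
  ultimately obtain v where v: "\<And>x. x \<in> T \<Longrightarrow> v \<bullet> x = l x"
    using riesz_on_subspace[of T l M] limI[OF add] limI[OF scale] unfolding l_def[symmetric]
    by metis
  show ?thesis
  proof (rule that)
    fix w c assume "(\<lambda>n. X n \<bullet> w) \<longlonglongrightarrow> c"
    then show "v \<bullet> w = c" using v[of w] by (auto simp: T_def l_def convergent_def limI)
  qed
qed

lemma nn_norm_diff_fn:
  "(\<integral>\<^sup>+x. ennreal ((norm (fn u x - fn v x))\<^sup>2) \<partial>lborel) = ennreal ((norm (u - v))\<^sup>2)"
  unfolding nn_norm_fn using fn_diff[of u v] by (intro nn_integral_cong_AE) auto

text \<open>Riesz-Fischer for a sequence of geometric speed. The weights \<open>4\<^sup>n\<close> keep the integral of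
  \<open>\<Sum>\<^sub>n 4\<^sup>n |f\<^sub>n\<^sub>+\<^sub>1 - f\<^sub>n|\<^sup>2\<close> finite, so that almost everywhere the increments are bounded by a
  multiple of \<open>2\<^sup>-\<^sup>n\<close> and the sequence converges. Fatou's lemma gives the estimate for the limit.\<close>
lemma L2_fast_Cauchy_convergent:
  fixes Y :: "nat \<Rightarrow> 'd::finite L2"
  assumes fast: "\<And>m n. m \<ge> n \<Longrightarrow> norm (Y m - Y n) \<le> (1 / 4) ^ n"
  shows "\<exists>v. \<forall>n. norm (v - Y n) \<le> (1 / 4) ^ n"
proof -
  define f where "f n = fn (Y n)" for n
  have [measurable]: "f n \<in> borel_measurable lborel" for n by (simp add: f_def)
  have diff: "(\<integral>\<^sup>+x. ennreal ((norm (f m x - f n x))\<^sup>2) \<partial>lborel) \<le> ennreal (((1/4) ^ n)\<^sup>2)"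
    if "m \<ge> n" for m n
    unfolding f_def nn_norm_diff_fn using fast[OF that] by (intro ennreal_leI power_mono) auto
  have "(\<integral>\<^sup>+x. (\<Sum>n. ennreal (4 ^ n) * ennreal ((norm (f (Suc n) x - f n x))\<^sup>2)) \<partial>lborel)
    = (\<Sum>n. ennreal (4 ^ n) * (\<integral>\<^sup>+x. ennreal ((norm (f (Suc n) x - f n x))\<^sup>2) \<partial>lborel))"
    by (simp add: nn_integral_suminf nn_integral_cmult)
  also have "\<dots> \<le> (\<Sum>n. ennreal ((1/4) ^ n))"
  proof (intro suminf_le summableI)
    fix n
    have "ennreal (4 ^ n) * (\<integral>\<^sup>+x. ennreal ((norm (f (Suc n) x - f n x))\<^sup>2) \<partial>lborel)
      \<le> ennreal (4 ^ n) * ennreal (((1/4) ^ n)\<^sup>2)"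
      by (intro mult_left_mono diff) auto
    also have "\<dots> = ennreal ((1/4) ^ n)"
      by (simp flip: ennreal_mult) (simp add: power2_eq_square power_divide)
    finally show "ennreal (4 ^ n) * (\<integral>\<^sup>+x. ennreal ((norm (f (Suc n) x - f n x))\<^sup>2) \<partial>lborel)
      \<le> ennreal ((1/4) ^ n)" .
  qed
  also have "\<dots> = ennreal (\<Sum>n. (1/4) ^ n)"
    by (intro suminf_ennreal2) (auto simp: summable_geometric)
  also have "\<dots> < \<infinity>" by simp
  finally have "AE x in lborel.
      (\<Sum>n. ennreal (4 ^ n) * ennreal ((norm (f (Suc n) x - f n x))\<^sup>2)) \<noteq> \<infinity>"
    by (intro nn_integral_noteq_infinite) auto
  then have conv: "AE x in lborel. convergent (\<lambda>n. f n x)"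
  proof eventually_elim
    case (elim x)
    let ?a = "\<lambda>n. 4 ^ n * (norm (f (Suc n) x - f n x))\<^sup>2"
    obtain C where C: "C \<ge> 0" "(\<Sum>n. ennreal (?a n)) = ennreal C"
      using elim by (cases "\<Sum>n. ennreal (?a n)") (auto simp: ennreal_mult)
    have bd: "norm (f (Suc n) x - f n x) \<le> sqrt C * (1/2) ^ n" for n
    proof -
      have "(\<Sum>k\<in>{n}. ennreal (?a k)) \<le> ennreal C"
        unfolding C(2)[symmetric] by (intro sum_le_suminf summableI) (simp_all only: finite.intros zero_le)
      then have "ennreal (?a n) \<le> ennreal C"
        by (simp only: sum.insert finite.intros sum.empty add_0_right empty_iff not_False_eq_True)
      then have "?a n \<le> C" using C(1) by (simp add: ennreal_le_iff)
      then have "(norm (f (Suc n) x - f n x))\<^sup>2 \<le> C / 4 ^ n" by (simp add: field_simps)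
      also have "\<dots> = (sqrt C * (1/2) ^ n)\<^sup>2"
      proof -
        have "((1/2::real) ^ n)\<^sup>2 = (1/4) ^ n"
          unfolding power_mult[symmetric] mult.commute[of n 2] unfolding power_mult by (simp add: power2_eq_square)
        then show ?thesis using C(1) by (simp add: power_mult_distrib power_one_over power_divide)
      qed
      finally show ?thesis by (rule power2_le_imp_le) (use C(1) in auto)
    qed
    have "summable (\<lambda>n. sqrt C * (1/2) ^ n)"
      by (intro summable_mult summable_geometric) simp
    then have "summable (\<lambda>n. f (Suc n) x - f n x)"
      by (rule summable_comparison_test') (rule bd)
    then have "convergent (\<lambda>n. \<Sum>k<n. f (Suc k) x - f k x)"
      by (simp add: summable_iff_convergent)
    then have "convergent (\<lambda>n. f n x - f 0 x)" by (simp add: sum_lessThan_telescope[of "\<lambda>n. f n x"])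
    then show ?case by (simp add: convergent_diff_const_right_iff)
  qed
  define g where "g x = lim (\<lambda>n. f n x)" for x
  have [measurable]: "g \<in> borel_measurable lborel"
    unfolding g_def by measurable
  have lim: "AE x in lborel. (\<lambda>n. f n x) \<longlonglongrightarrow> g x"
    using conv by (simp add: g_def convergent_LIMSEQ_iff)
  have fatou: "(\<integral>\<^sup>+x. ennreal ((norm (g x - f n x))\<^sup>2) \<partial>lborel) \<le> ennreal (((1/4) ^ n)\<^sup>2)" for n
  proof -
    have "(\<integral>\<^sup>+x. ennreal ((norm (g x - f n x))\<^sup>2) \<partial>lborel)
      = (\<integral>\<^sup>+x. liminf (\<lambda>m. ennreal ((norm (f m x - f n x))\<^sup>2)) \<partial>lborel)"
    proof (intro nn_integral_cong_AE)
      show "AE x in lborel. ennreal ((norm (g x - f n x))\<^sup>2)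
          = liminf (\<lambda>m. ennreal ((norm (f m x - f n x))\<^sup>2))"
        using lim
      proof eventually_elim
        case (elim x)
        then have "(\<lambda>m. ennreal ((norm (f m x - f n x))\<^sup>2)) \<longlonglongrightarrow> ennreal ((norm (g x - f n x))\<^sup>2)"
          by (intro tendsto_ennrealI tendsto_intros)
        then show ?case by (rule lim_imp_Liminf[OF sequentially_bot, symmetric])
      qed
    qed
    also have "\<dots> \<le> liminf (\<lambda>m. \<integral>\<^sup>+x. ennreal ((norm (f m x - f n x))\<^sup>2) \<partial>lborel)"
      by (intro nn_integral_liminf) measurable
    also have "\<dots> \<le> ennreal (((1/4) ^ n)\<^sup>2)"
    proof -
      have "liminf (\<lambda>m. \<integral>\<^sup>+x. ennreal ((norm (f m x - f n x))\<^sup>2) \<partial>lborel)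
        \<le> liminf (\<lambda>m. ennreal (((1/4) ^ n)\<^sup>2))"
        by (intro Liminf_mono) (auto intro!: eventually_sequentiallyI[of n] diff)
      then show ?thesis by (simp add: Liminf_const)
    qed
    finally show ?thesis .
  qed
  have sq: "square_integrable (\<lambda>x. g x - f n x)" for n
    using le_less_trans[OF fatou[of n] ennreal_less_top] unfolding square_integrable_def
    by (simp add: integrable_iff_bounded)
  have "square_integrable g"
    using square_integrable_add[OF sq[of 0] square_integrable_fn[of "Y 0"]] by (simp add: f_def)
  then have "abs_L2 g - Y n = abs_L2 (\<lambda>x. g x - f n x)" for n
    using minus_L2.abs_eq[of g "fn (Y n)"] by (simp add: L2_rel_def f_def)
  then have "ennreal ((norm (abs_L2 g - Y n))\<^sup>2) \<le> ennreal (((1/4) ^ n)\<^sup>2)" for n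
    using nn_norm_abs_L2[OF sq[of n]] fatou[of n] by simp
  then have "(norm (abs_L2 g - Y n))\<^sup>2 \<le> ((1/4) ^ n)\<^sup>2" for n
    by (subst (asm) ennreal_le_iff) simp_all
  then have "norm (abs_L2 g - Y n) \<le> (1/4) ^ n" for n
    by (rule power2_le_imp_le) simp
  then show ?thesis by blast
qed

instance L2 :: (finite) complete_space
proof
  fix X :: "nat \<Rightarrow> 'a L2" assume "Cauchy X"
  then have "\<exists>N. \<forall>m\<ge>N. \<forall>k\<ge>N. dist (X m) (X k) < (1/4) ^ n" for n
    unfolding Cauchy_def by simp
  then obtain N where N: "\<And>n m k. m \<ge> N n \<Longrightarrow> k \<ge> N n \<Longrightarrow> dist (X m) (X k) < (1/4) ^ n"
    by metis
  \<comment> \<open>Summing makes the chosen indices monotone.\<close>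
  define r where "r n = (\<Sum>i\<le>n. N i)" for n
  have r: "N n \<le> r m" if "n \<le> m" for m n
    unfolding r_def using that by (intro member_le_sum) auto
  have "norm (X (r m) - X (r n)) \<le> (1/4) ^ n" if "m \<ge> n" for m n
    using N[OF r[OF that] r[OF order_refl]] by (simp add: dist_norm)
  then obtain v where v: "\<And>n. norm (v - X (r n)) \<le> (1/4) ^ n"
    using L2_fast_Cauchy_convergent[of "\<lambda>n. X (r n)"] by blast
  have "X \<longlonglongrightarrow> v"
  proof (rule metric_LIMSEQ_I)
    fix e :: real assume "e > 0"
    then obtain n where n: "(1/4::real) ^ n < e / 2" using real_arch_pow_inv[of "e/2" "1/4"] by auto
    have "dist (X m) v < e" if "m \<ge> N n" for m
      using dist_triangle[of "X m" v "X (r n)"] N[OF that r[OF order_refl]] v[of n] n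
      by (simp add: dist_norm norm_minus_commute)
    then show "\<exists>no. \<forall>n\<ge>no. dist (X n) v < e" by blast
  qed
  then show "convergent X" by (auto simp: convergent_def)
qed

section \<open>Smooth functions of compact support\<close>

text \<open>Smoothness quantifies over all iterated partial derivatives; it is easiest to prove by exhibiting a set of
  differentiable functions that is closed under partial derivatives.\<close>
lemma smooth_coinduct:
  assumes "\<phi> \<in> A"
    and "\<And>f x. f \<in> A \<Longrightarrow> f differentiable (at x)"
    and "\<And>f i. f \<in> A \<Longrightarrow> pd i f \<in> A"
  shows "smooth \<phi>"
proof -
  have "foldr pd is \<phi> \<in> A" for "is"
    by (induction "is") (simp_all add: assms)
  then show ?thesis unfolding smooth_def using assms(2) by blast
qed

lemma smooth_differentiable: "smooth f \<Longrightarrow> f differentiable (at x)"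
  unfolding smooth_def by (metis foldr.simps(1) id_apply)

lemma smooth_pd: "smooth f \<Longrightarrow> smooth (pd i f)"
proof -
  assume "smooth f"
  then have "foldr pd (is @ [i]) f differentiable (at x)" for "is" x
    unfolding smooth_def by blast
  then show ?thesis unfolding smooth_def by simp
qed

lemma pd_eqI: "(f has_derivative D) (at x) \<Longrightarrow> pd i f x = D (axis i 1)"
  unfolding pd_def using frechet_derivative_at by metis

lemma has_derivative_frechet:
  "f differentiable (at x) \<Longrightarrow> (f has_derivative frechet_derivative f (at x)) (at x)"
  by (simp add: frechet_derivative_works)

lemma pd_add:
  assumes "f differentiable (at x)" "g differentiable (at x)"
  shows "pd i (\<lambda>x. f x + g x) x = pd i f x + pd i g x"
  using pd_eqI[OF has_derivative_add[OF assms[THEN has_derivative_frechet]]] by (simp add: pd_def)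

lemma pd_mult:
  assumes "f differentiable (at x)" "g differentiable (at x)"
  shows "pd i (\<lambda>x. f x * g x) x = f x * pd i g x + pd i f x * g x"
  using pd_eqI[OF has_derivative_mult[OF assms[THEN has_derivative_frechet]]] by (simp add: pd_def)

lemma has_derivative_shift:
  assumes "(f has_derivative D) (at (x + h))"
  shows "((\<lambda>x. f (x + h)) has_derivative D) (at x)"
proof -
  have "((\<lambda>x. x + h) has_derivative (\<lambda>x. x)) (at x)"
    by (auto intro!: derivative_eq_intros)
  from has_derivative_compose[OF this assms] show ?thesis by simp
qed

lemma differentiable_shift:
  "f differentiable (at (x + h)) \<Longrightarrow> (\<lambda>x. f (x + h)) differentiable (at x)"
  unfolding differentiable_def using has_derivative_shift by blast

lemma pd_shift:
  assumes "\<And>x. f differentiable (at x)" shows "pd i (\<lambda>x. f (x + h)) = (\<lambda>x. pd i f (x + h))"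
  using pd_eqI[OF has_derivative_shift[OF has_derivative_frechet[OF assms]]] by (auto simp: pd_def)

text \<open>Products of two smooth functions are not closed under partial derivatives, but by the Leibniz rule
  their sums are.\<close>
inductive_set products :: "(real^'d::finite \<Rightarrow> real) set" where
  "smooth f \<Longrightarrow> smooth g \<Longrightarrow> (\<lambda>x. f x * g x) \<in> products"
| "f \<in> products \<Longrightarrow> g \<in> products \<Longrightarrow> (\<lambda>x. f x + g x) \<in> products"

lemma products_differentiable: "f \<in> products \<Longrightarrow> f differentiable (at x)"
  by (induction rule: products.induct)
     (simp_all add: differentiable_mult differentiable_add smooth_differentiable)

lemma products_pd: "f \<in> products \<Longrightarrow> pd i f \<in> products"
proof (induction rule: products.induct)
  case (1 f g)
  then have "pd i (\<lambda>x. f x * g x) = (\<lambda>x. f x * pd i g x + pd i f x * g x)"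
    by (auto simp: pd_mult smooth_differentiable)
  then show ?case using 1 by (auto intro!: products.intros smooth_pd)
next
  case (2 f g)
  then have "pd i (\<lambda>x. f x + g x) = (\<lambda>x. pd i f x + pd i g x)"
    by (auto simp: pd_add products_differentiable)
  then show ?case using 2 by (auto intro!: products.intros)
qed

lemma smooth_mult: "smooth f \<Longrightarrow> smooth g \<Longrightarrow> smooth (\<lambda>x. f x * g x)"
  by (rule smooth_coinduct[where A = products])
     (auto intro: products.intros products_differentiable products_pd)

lemma smooth_shift:
  assumes "smooth f" shows "smooth (\<lambda>x. f (x + h))"
proof (rule smooth_coinduct[where A = "{(\<lambda>x. g (x + h)) | g. smooth g}"])
  fix f x assume "f \<in> {\<lambda>x. g (x + h) |g. smooth g}"
  then show "f differentiable at x" using differentiable_shift smooth_differentiable by blast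
next
  fix f i assume "f \<in> {\<lambda>x. g (x + h) |g. smooth g}"
  then obtain g where "f = (\<lambda>x. g (x + h))" "smooth g" by blast
  then show "pd i f \<in> {\<lambda>x. g (x + h) |g. smooth g}"
    using pd_shift[of g i h] smooth_differentiable smooth_pd by blast
qed (use assms in blast)

lemma test_function_differentiable: "test_function \<phi> \<Longrightarrow> \<phi> differentiable (at x)"
  by (simp add: test_function_def smooth_differentiable)

lemma test_function_pd:
  assumes "test_function \<phi>" shows "test_function (pd i \<phi>)"
proof -
  obtain K where K: "compact K" "\<And>x. x \<notin> K \<Longrightarrow> \<phi> x = 0"
    using assms by (auto simp: test_function_def)
  have "pd i \<phi> x = 0" if "x \<notin> K" for x
  proof -
    have "open (- K)" using K(1) by (simp add: compact_imp_closed open_Compl)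
    then have "(\<phi> has_derivative (\<lambda>h. 0)) (at x)"
      by (rule has_derivative_transform_within_open[OF has_derivative_const]) (use K(2) that in auto)
    from pd_eqI[OF this] show ?thesis .
  qed
  then show ?thesis using assms K(1) by (auto simp: test_function_def smooth_pd)
qed

lemma test_function_shift:
  assumes "test_function \<phi>" shows "test_function (\<lambda>x. \<phi> (x + h))"
proof -
  obtain K where K: "compact K" "\<And>x. x \<notin> K \<Longrightarrow> \<phi> x = 0"
    using assms by (auto simp: test_function_def)
  have "compact ((\<lambda>x. x - h) ` K)"
    using compact_translation[OF K(1), of "-h"] by (simp add: add.commute)
  moreover have "\<phi> (x + h) = 0" if "x \<notin> (\<lambda>x. x - h) ` K" for x
  proof -
    have "x + h \<notin> K" using that by (auto simp: image_iff dest: bspec[of _ _ "x + h"])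
    then show ?thesis by (rule K(2))
  qed
  ultimately show ?thesis using assms smooth_shift by (auto simp: test_function_def)
qed

lemma test_function_continuous: "test_function \<phi> \<Longrightarrow> continuous_on A \<phi>"
  by (intro continuous_at_imp_continuous_on ballI differentiable_imp_continuous_within
      test_function_differentiable)

lemma test_function_measurable: "test_function \<phi> \<Longrightarrow> \<phi> \<in> borel_measurable lborel"
  by (simp add: borel_measurable_continuous_onI test_function_continuous)

lemma test_function_bounded:
  assumes "test_function \<phi>" obtains C where "C > 0" "\<And>x. \<bar>\<phi> x\<bar> \<le> C"
proof -
  obtain K where K: "compact K" "\<And>x. x \<notin> K \<Longrightarrow> \<phi> x = 0"
    using assms by (auto simp: test_function_def)
  have "bounded (\<phi> ` K)"
    using K(1) assms by (simp add: compact_continuous_image compact_imp_bounded test_function_continuous)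
  then obtain C where "C > 0" "\<And>x. x \<in> K \<Longrightarrow> \<bar>\<phi> x\<bar> \<le> C"
    by (auto simp: bounded_pos)
  then show ?thesis using K(2) by (intro that[of C]) (force+)
qed

text \<open>For \<open>p = 1\<close> this is the classical smooth function that is flat at the origin. A polynomial in \<open>1/x\<close> is
  carried along because the derivatives have this form.\<close>
definition cutoff :: "real poly \<Rightarrow> real \<Rightarrow> real"
  where "cutoff p x = (if x > 0 then poly p (1 / x) * exp (- (1 / x)) else 0)"

definition cutoff_deriv :: "real poly \<Rightarrow> real poly"
  where "cutoff_deriv p = [:0, 0, 1:] * (p - pderiv p)"

lemma poly_times_exp_minus_tendsto_0: "((\<lambda>y. poly p y * exp (- y)) \<longlongrightarrow> 0) (at_top :: real filter)"
proof -
  have "((\<lambda>y. \<Sum>i\<le>degree p. coeff p i * (y ^ i / exp y)) \<longlongrightarrow> (\<Sum>i\<le>degree p. coeff p i * 0)) at_top"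
    by (intro tendsto_intros tendsto_power_div_exp_0)
  then show ?thesis
    by (simp add: poly_altdef exp_minus sum_distrib_right divide_inverse mult.assoc)
qed

text \<open>Only the origin is critical: there the difference quotient from the right is \<open>y p(y) exp(-y)\<close> with
  \<open>y = 1/h\<close> tending to infinity.\<close>
lemma DERIV_cutoff: "(cutoff p has_real_derivative cutoff (cutoff_deriv p) x) (at x)"
proof (cases x "0::real" rule: linorder_cases)
  case less
  have "((\<lambda>x. 0) has_real_derivative 0) (at x)" by simp
  then have "(cutoff p has_real_derivative 0) (at x)"
    by (rule has_field_derivative_transform_within_open[of _ _ _ "{..<0}"])
       (use less in \<open>auto simp: cutoff_def\<close>)
  then show ?thesis using less by (simp add: cutoff_def)
next
  case greater
  have "((\<lambda>x. poly p (1 / x) * exp (- (1 / x))) has_real_derivative cutoff (cutoff_deriv p) x) (at x)"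
    using greater
    by (auto intro!: derivative_eq_intros simp: cutoff_def cutoff_deriv_def field_simps power2_eq_square)
  then show ?thesis
    by (rule has_field_derivative_transform_within_open[of _ _ _ "{0<..}"])
       (use greater in \<open>auto simp: cutoff_def\<close>)
next
  case equal
  have "((\<lambda>h. cutoff p h / h) \<longlongrightarrow> 0) (at 0)"
  proof (rule filterlim_split_at)
    have "eventually (\<lambda>h. cutoff p h / h = 0) (at_left (0::real))"
      by (auto simp: eventually_at_left_field cutoff_def intro!: exI[of _ "-1"])
    then show "((\<lambda>h. cutoff p h / h) \<longlongrightarrow> 0) (at_left 0)"
      by (rule tendsto_eventually)
    have "((\<lambda>h. poly (pCons 0 p) (inverse h) * exp (- inverse h)) \<longlongrightarrow> 0) (at_right 0)"
      by (rule filterlim_compose[OF poly_times_exp_minus_tendsto_0 filterlim_inverse_at_top_right])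
    moreover have "eventually (\<lambda>h. poly (pCons 0 p) (inverse h) * exp (- inverse h) = cutoff p h / h)
        (at_right (0::real))"
      by (auto simp: eventually_at_right_field cutoff_def field_simps intro!: exI[of _ 1])
    ultimately show "((\<lambda>h. cutoff p h / h) \<longlongrightarrow> 0) (at_right 0)"
      by (rule Lim_transform_eventually)
  qed
  then show ?thesis using equal by (simp add: DERIV_def cutoff_def)
qed

text \<open>The constant factor in the invariant set absorbs the inner derivative, and is zero for the directions in
  which the function is constant.\<close>
lemma smooth_cutoff_coordinate: "smooth (\<lambda>x :: real^'d::finite. cutoff p (s * x $ i + t))"
proof (rule smooth_coinduct[where A = "{(\<lambda>x. c * cutoff p (s * x $ i + t)) | c p. True}"])
  have der: "((\<lambda>x :: real^'d. c * cutoff p (s * x $ i + t)) has_derivative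
      (\<lambda>v. c * (cutoff (cutoff_deriv p) (s * x $ i + t) * (s * v $ i)))) (at x)" for c p x
  proof -
    have "((\<lambda>x :: real^'d. s * x $ i + t) has_derivative (\<lambda>v. s * v $ i)) (at x)"
      by (auto intro!: derivative_eq_intros bounded_linear_imp_has_derivative bounded_linear_vec_nth)
    from has_derivative_compose[OF this, of "cutoff p" "\<lambda>v. cutoff (cutoff_deriv p) (s * x $ i + t) * v"]
    show ?thesis
      using DERIV_cutoff[of p "s * x $ i + t"]
      by (intro has_derivative_mult_right) (simp add: has_field_derivative_def)
  qed
  show "f differentiable at x" if "f \<in> {(\<lambda>x. c * cutoff p (s * x $ i + t)) | c p. True}" for f and x :: "real^'d"
    using that der unfolding differentiable_def by blast
  show "pd j f \<in> {(\<lambda>x. c * cutoff p (s * x $ i + t)) | c p. True}"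
    if mem: "f \<in> {(\<lambda>x. c * cutoff p (s * x $ i + t)) | c p. True}" for f :: "real^'d \<Rightarrow> real" and j
  proof -
    obtain c p where f: "f = (\<lambda>x. c * cutoff p (s * x $ i + t))" using mem by blast
    have "pd j f = (\<lambda>x. (c * (s * axis j 1 $ i)) * cutoff (cutoff_deriv p) (s * x $ i + t))"
      unfolding f using pd_eqI[OF der] by (auto simp: algebra_simps)
    then show ?thesis by blast
  qed
  show "(\<lambda>x. cutoff p (s * x $ i + t)) \<in> {(\<lambda>x. c * cutoff p (s * x $ i + t)) | c p. True}"
    by (auto intro!: exI[of _ 1] exI[of _ p])
qed

lemma smooth_const: "smooth (\<lambda>x :: real^'d::finite. c)"
proof (rule smooth_coinduct[where A = "{(\<lambda>x. c) | c. True}"])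
  show "pd j f \<in> {(\<lambda>x. c) | c. True}" if mem: "f \<in> {(\<lambda>x. c) | c. True}" for f :: "real^'d \<Rightarrow> real" and j
  proof -
    obtain c where "f = (\<lambda>x. c)" using mem by blast
    then have "pd j f = (\<lambda>x. 0)" using pd_eqI[OF has_derivative_const[of c]] by auto
    then show ?thesis by auto
  qed
qed auto

lemma smooth_prod:
  "finite I \<Longrightarrow> (\<And>i. i \<in> I \<Longrightarrow> smooth (f i)) \<Longrightarrow> smooth (\<lambda>x. \<Prod>i\<in>I. f i x)"
  by (induction rule: finite_induct) (auto intro!: smooth_const smooth_mult)

text \<open>One factor for each face of the box \<open>(a, b)\<close>. Within the box the factors are
  \<open>exp(-1/((m+1) r))\<close>, with \<open>r\<close> the distance to the face, and tend to 1; outside the box one of them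
  vanishes. The bumps thus approximate the indicator of the box.\<close>
definition bump :: "real^'d::finite \<Rightarrow> real^'d \<Rightarrow> nat \<Rightarrow> real^'d \<Rightarrow> real"
  where "bump a b m x =
    (\<Prod>i\<in>UNIV. cutoff 1 (real (Suc m) * x $ i + - (real (Suc m) * a $ i)) *
      cutoff 1 (- real (Suc m) * x $ i + real (Suc m) * b $ i))"

lemma bump_pos_neg:
  "0 < real (Suc m) * x + - (real (Suc m) * a) \<longleftrightarrow> a < (x::real)"
  "0 < - real (Suc m) * x + real (Suc m) * b \<longleftrightarrow> x < (b::real)"
  by (auto simp: mult_less_cancel_left simp del: of_nat_Suc)

lemma bump_support: "x \<notin> cbox a b \<Longrightarrow> bump a b m x = 0"
proof -
  assume "x \<notin> cbox a b"
  then obtain i where "\<not> (a $ i \<le> x $ i \<and> x $ i \<le> b $ i)" by (auto simp: mem_box_cart)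
  then have "cutoff 1 (real (Suc m) * x $ i + - (real (Suc m) * a $ i)) *
    cutoff 1 (- real (Suc m) * x $ i + real (Suc m) * b $ i) = 0"
    unfolding cutoff_def bump_pos_neg by auto
  then show ?thesis unfolding bump_def by (intro prod_zero) auto
qed

lemma test_function_bump: "test_function (bump a b m)"
  unfolding test_function_def bump_def
  using bump_support[unfolded bump_def]
  by (intro conjI exI[of _ "cbox a b"] allI impI smooth_prod smooth_mult smooth_cutoff_coordinate
      compact_cbox finite) blast

lemma cutoff_1_bounds: "0 \<le> cutoff 1 x" "cutoff 1 x \<le> 1"
  by (auto simp: cutoff_def)

lemma bump_bounds: "0 \<le> bump a b m x" "bump a b m x \<le> 1"
  unfolding bump_def
  by (auto intro!: prod_nonneg prod_le_1 mult_nonneg_nonneg mult_le_one simp: cutoff_1_bounds)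

lemma bump_tendsto_indicator: "(\<lambda>m. bump a b m x) \<longlonglongrightarrow> indicator (box a b) x"
proof (cases "x \<in> box a b")
  case False
  then obtain i where "\<not> (a $ i < x $ i \<and> x $ i < b $ i)"
    by (auto simp: mem_box_cart)
  then have "cutoff 1 (real (Suc m) * x $ i + - (real (Suc m) * a $ i)) *
      cutoff 1 (- real (Suc m) * x $ i + real (Suc m) * b $ i) = 0" for m
    unfolding cutoff_def bump_pos_neg by auto
  then have "bump a b m x = 0" for m
    unfolding bump_def by (intro prod_zero finite bexI[of _ i]) simp_all
  then show ?thesis using False by simp
next
  case True
  have lim: "(\<lambda>m. cutoff 1 (real (Suc m) * c)) \<longlonglongrightarrow> 1" if "c > 0" for c :: real
  proof -
    have "(\<lambda>m. inverse (real (Suc m)) * (1 / c)) \<longlonglongrightarrow> 0 * (1 / c)"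
      by (intro tendsto_intros LIMSEQ_inverse_real_of_nat)
    then have "(\<lambda>m. exp (- (inverse (real (Suc m)) * (1 / c)))) \<longlonglongrightarrow> exp (- (0 * (1 / c)))"
      by (rule tendsto_exp[OF tendsto_minus])
    moreover have "cutoff 1 (real (Suc m) * c) = exp (- (inverse (real (Suc m)) * (1 / c)))" for m
    proof -
      have "0 < real (Suc m) * c" using that by simp
      then show ?thesis by (simp add: cutoff_def divide_inverse mult.commute del: of_nat_Suc)
    qed
    ultimately show ?thesis by simp
  qed
  have "(\<lambda>m. \<Prod>i\<in>UNIV. cutoff 1 (real (Suc m) * (x $ i - a $ i)) * cutoff 1 (real (Suc m) * (b $ i - x $ i)))
     \<longlonglongrightarrow> (\<Prod>i\<in>(UNIV::'a set). 1 * 1)"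
    using True by (intro tendsto_prod tendsto_mult lim) (auto simp: mem_box_cart)
  then show ?thesis using True
    by (simp add: bump_def algebra_simps del: of_nat_Suc)
qed

section \<open>Test functions as vectors\<close>

text \<open>The positive and the negative part of \<open>g\<close> are densities of measures that agree on open boxes, a
  generator of the Borel sets that is stable under intersections.\<close>
lemma AE_zero_if_box_integrals_zero:
  fixes g :: "'a::euclidean_space \<Rightarrow> real"
  assumes [measurable]: "g \<in> borel_measurable lborel"
    and int: "\<And>a b. integrable lborel (\<lambda>x. indicator (box a b) x * g x)"
    and zero: "\<And>a b. (\<integral>x. indicator (box a b) x * g x \<partial>lborel) = 0"
  shows "AE x in lborel. g x = 0"
proof -
  let ?M = "\<lambda>f. density lborel (\<lambda>x. ennreal (f x))"
  have em: "emeasure (?M f) (box a b) = (\<integral>\<^sup>+x. ennreal (indicator (box a b) x * f x) \<partial>lborel)"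
    if [measurable]: "f \<in> borel_measurable lborel" for f :: "'a \<Rightarrow> real" and a b
    by (simp add: emeasure_density, intro nn_integral_cong) (auto simp: indicator_def)
  have fin: "(\<integral>\<^sup>+x. ennreal (indicator (box a b) x * g x) \<partial>lborel) < \<infinity>"
    "(\<integral>\<^sup>+x. ennreal (indicator (box a b) x * - g x) \<partial>lborel) < \<infinity>" for a b
    using int[of a b] by (auto simp: real_integrable_def top.not_eq_extremum)
  have eq: "emeasure (?M g) (box a b) = emeasure (?M (\<lambda>x. - g x)) (box a b)" for a b
  proof -
    have "enn2real (\<integral>\<^sup>+x. ennreal (indicator (box a b) x * g x) \<partial>lborel)
        = enn2real (\<integral>\<^sup>+x. ennreal (indicator (box a b) x * - g x) \<partial>lborel)"
      using real_lebesgue_integral_def[OF int[of a b]] zero[of a b] by simp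
    then have "ennreal (enn2real (\<integral>\<^sup>+x. ennreal (indicator (box a b) x * g x) \<partial>lborel))
        = ennreal (enn2real (\<integral>\<^sup>+x. ennreal (indicator (box a b) x * - g x) \<partial>lborel))"
      by simp
    then show ?thesis
      using fin[of a b] by (simp only: em ennreal_enn2real infinity_ennreal_def assms(1) borel_measurable_uminus)
  qed
  have "?M g = ?M (\<lambda>x. - g x)"
  proof (rule measure_eqI_generator_eq)
    let ?E = "range (\<lambda>(a, b). box a b::'a set)"
    let ?A = "\<lambda>n::nat. box (- (real n *\<^sub>R One)) (real n *\<^sub>R One) :: 'a set"
    show "Int_stable ?E" by (auto simp: Int_stable_def box_Int_box)
    show "?E \<subseteq> Pow UNIV" "sets (?M g) = sigma_sets UNIV ?E"
      "sets (?M (\<lambda>x. - g x)) = sigma_sets UNIV ?E"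
      by (simp_all add: borel_eq_box)
    show "range ?A \<subseteq> ?E" "(\<Union>i. ?A i) = UNIV" unfolding UN_box_eq_UNIV by auto
    show "emeasure (?M g) (?A i) \<noteq> \<infinity>" for i
      using fin(1)[of "- (real i *\<^sub>R One)" "real i *\<^sub>R One"] by (simp add: em)
    show "emeasure (?M g) X = emeasure (?M (\<lambda>x. - g x)) X" if "X \<in> ?E" for X
      using that eq by auto
  qed
  then have "AE x in lborel. ennreal (g x) = ennreal (- g x)"
    by (subst (asm) sigma_finite_measure.density_unique_iff[OF sigma_finite_lborel]) auto
  then show ?thesis
  proof eventually_elim
    case (elim x)
    then show ?case by (cases "g x \<ge> 0") (auto simp: ennreal_eq_0_iff ennreal_neg)
  qed
qed

lemma square_integrable_locally_integrable:
  assumes "square_integrable f" and [measurable]: "K \<in> sets borel" and "emeasure lborel K < \<infinity>"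
  shows "integrable lborel (\<lambda>x. indicator K x *\<^sub>R f x)"
proof (rule Bochner_Integration.integrable_bound)
  have [measurable]: "f \<in> borel_measurable lborel"
    using assms(1) by (simp add: square_integrable_def)
  show "(\<lambda>x. indicator K x *\<^sub>R f x) \<in> borel_measurable lborel" by measurable
  show "integrable lborel (\<lambda>x. (norm (f x))\<^sup>2 + indicator K x)"
    using assms by (auto simp: square_integrable_def intro!: integrable_real_indicator)
  have "norm (f x) \<le> (norm (f x))\<^sup>2 + 1" for x
    using sum_squares_bound[of "norm (f x)" 1] by simp (smt (verit) zero_le_power2)
  then show "AE x in lborel. norm (indicator K x *\<^sub>R f x) \<le> norm ((norm (f x))\<^sup>2 + indicator K x)"
    by (intro always_eventually allI) (auto simp: indicator_def)
qed

lemma square_integrable_if_bounded_support: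
  assumes [measurable]: "f \<in> borel_measurable lborel"
    and "compact K" "\<And>x. norm (f x) \<le> C" "\<And>x. x \<notin> K \<Longrightarrow> f x = 0"
  shows "square_integrable f"
  unfolding square_integrable_def
proof
  have [measurable]: "K \<in> sets borel" using assms(2) by (rule borel_compact)
  show "integrable lborel (\<lambda>x. (norm (f x))\<^sup>2)"
  proof (rule Bochner_Integration.integrable_bound)
    show "integrable lborel (\<lambda>x. C\<^sup>2 * indicator K x)"
      using emeasure_compact_finite[OF assms(2)] by simp
    have "(norm (f x))\<^sup>2 \<le> C\<^sup>2 * indicator K x" for x
      using assms(3)[of x] assms(4)[of x] by (auto simp: indicator_def intro: power_mono)
    then show "AE x in lborel. norm ((norm (f x))\<^sup>2) \<le> norm (C\<^sup>2 * indicator K x)"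
      by (auto intro!: always_eventually simp: abs_of_nonneg)
  qed measurable
qed fact

definition test_vector :: "complex \<Rightarrow> (real^'d::finite \<Rightarrow> real) \<Rightarrow> 'd L2"
  where "test_vector c \<phi> = abs_L2 (\<lambda>x. c * of_real (\<phi> x))"

lemma square_integrable_test_function:
  assumes "test_function \<phi>" shows "square_integrable (\<lambda>x. c * of_real (\<phi> x))"
proof -
  note [measurable] = test_function_measurable[OF assms]
  obtain K where K: "compact K" "\<And>x. x \<notin> K \<Longrightarrow> \<phi> x = 0"
    using assms by (auto simp: test_function_def)
  obtain C where C: "\<And>x. \<bar>\<phi> x\<bar> \<le> C" using test_function_bounded[OF assms] by metis
  show ?thesis
    by (rule square_integrable_if_bounded_support[OF _ K(1), of _ "norm c * C"])
       (auto simp: norm_mult K C mult_left_mono)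
qed

text \<open>Letting the complex factor \<open>c\<close> vary recovers the complex integral from the real inner product; the weak
  derivatives, which are defined by complex integrals, can thus be treated in the real Hilbert space.\<close>
lemma inner_test_vector:
  assumes "test_function \<phi>"
  shows "u \<bullet> test_vector c \<phi> = Re (cnj c * (\<integral>x. \<phi> x *\<^sub>R fn u x \<partial>lborel))"
proof -
  note [measurable] = test_function_measurable[OF assms] 
  have "(\<integral>x. fn u x * cnj (fn (test_vector c \<phi>) x) \<partial>lborel)
      = (\<integral>x. cnj c * (\<phi> x *\<^sub>R fn u x) \<partial>lborel)"
    using fn_abs_L2[OF square_integrable_test_function[OF assms, of c]]
    by (intro integral_cong_AE borel_measurable_integrable[OF square_integrable_mult_cnj])
       (auto simp: test_vector_def scaleR_conv_of_real)
  also have "\<dots> = cnj c * (\<integral>x. \<phi> x *\<^sub>R fn u x \<partial>lborel)"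
    by (rule integral_mult_right_zero)
  finally show ?thesis by (simp only: inner_fn)
qed

lemma complex_eq_iff_all_Re: "a = b \<longleftrightarrow> (\<forall>c. Re (cnj c * a) = Re (cnj c * b))"
  using complex_eq_iff by (auto dest: spec[of _ 1] spec[of _ \<i>])

text \<open>Dominated convergence along bump functions shows that the integral of the function over every
  box vanishes.\<close>
lemma test_vectors_separate:
  assumes "\<And>c \<phi>. test_function \<phi> \<Longrightarrow> u \<bullet> test_vector c \<phi> = 0"
  shows "u = 0"
proof -
  let ?f = "fn u"
  have zero: "(\<integral>x. \<phi> x *\<^sub>R ?f x \<partial>lborel) = 0" if "test_function \<phi>" for \<phi>
    unfolding complex_eq_iff_all_Re using assms[OF that] by (simp add: inner_test_vector that)
  have int: "integrable lborel (\<lambda>x. indicator (cbox a b) x *\<^sub>R ?f x)"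
    "integrable lborel (\<lambda>x. indicator (box a b) x *\<^sub>R ?f x)" for a b
    by (intro square_integrable_locally_integrable square_integrable_fn emeasure_bounded_finite
        bounded_cbox bounded_box; simp)+
  have "(\<lambda>m. \<integral>x. bump a b m x *\<^sub>R ?f x \<partial>lborel) \<longlonglongrightarrow> (\<integral>x. indicator (box a b) x *\<^sub>R ?f x \<partial>lborel)" for a b
  proof (rule integral_dominated_convergence)
    note [measurable] = test_function_measurable[OF test_function_bump[of a b]]
    show "(\<lambda>x. bump a b m x *\<^sub>R ?f x) \<in> borel_measurable lborel" for m by measurable
    show "(\<lambda>x. indicator (box a b) x *\<^sub>R ?f x) \<in> borel_measurable lborel"
      by measurable
    show "integrable lborel (\<lambda>x. norm (indicator (cbox a b) x *\<^sub>R ?f x))"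
      by (intro integrable_norm int)
    show "AE x in lborel. (\<lambda>m. bump a b m x *\<^sub>R ?f x) \<longlonglongrightarrow> indicator (box a b) x *\<^sub>R ?f x"
      by (intro always_eventually allI tendsto_scaleR bump_tendsto_indicator tendsto_const)
    show "AE x in lborel. norm (bump a b m x *\<^sub>R ?f x) \<le> norm (indicator (cbox a b) x *\<^sub>R ?f x)" for m
      using bump_bounds[of a b m]
      by (intro always_eventually allI)
         (auto simp: indicator_def bump_support abs_of_nonneg intro: mult_left_le_one_le)
  qed
  then have box: "(\<integral>x. indicator (box a b) x *\<^sub>R ?f x \<partial>lborel) = 0" for a b
    by (simp add: zero[OF test_function_bump] LIMSEQ_const_iff)
  have "AE x in lborel. Re (?f x) = 0"
  proof (rule AE_zero_if_box_integrals_zero)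
    fix a b :: "real^'a"
    show "integrable lborel (\<lambda>x. indicator (box a b) x * Re (?f x))"
      using integrable_Re[OF int(2)[of a b]] by simp
    show "(\<integral>x. indicator (box a b) x * Re (?f x) \<partial>lborel) = 0"
      using integral_Re[OF int(2)[of a b]] box[of a b] by simp
  qed measurable
  moreover have "AE x in lborel. Im (?f x) = 0"
  proof (rule AE_zero_if_box_integrals_zero)
    fix a b :: "real^'a"
    show "integrable lborel (\<lambda>x. indicator (box a b) x * Im (?f x))"
      using integrable_Im[OF int(2)[of a b]] by simp
    show "(\<integral>x. indicator (box a b) x * Im (?f x) \<partial>lborel) = 0"
      using integral_Im[OF int(2)[of a b]] box[of a b] by simp
  qed measurable
  ultimately have "AE x in lborel. norm (?f x) = 0"
    by eventually_elim (simp add: complex_eq_iff)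
  then have "ennreal ((norm u)\<^sup>2) = 0"
    unfolding nn_norm_fn by (subst nn_integral_0_iff_AE) auto
  then show ?thesis by simp
qed

lemma translate_test_vector:
  assumes "test_function \<phi>"
  shows "translate h (test_vector c \<phi>) = test_vector c (\<lambda>x. \<phi> (x + h))"
  unfolding test_vector_def
  by (rule translate_abs_L2[OF square_integrable_test_function[OF assms]])

definition diff_quot :: "'d \<Rightarrow> real \<Rightarrow> 'd::finite L2 \<Rightarrow> 'd L2"
  where "diff_quot i h u = (translate (h *\<^sub>R axis i 1) u - u) /\<^sub>R h"

lemma DERIV_along_axis:
  assumes "test_function \<phi>"
  shows "((\<lambda>s. \<phi> (x + s *\<^sub>R axis i 1)) has_real_derivative pd i \<phi> (x + s *\<^sub>R axis i 1)) (at s)"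
proof -
  let ?D = "frechet_derivative \<phi> (at (x + s *\<^sub>R axis i 1))"
  have phi: "(\<phi> has_derivative ?D) (at (x + s *\<^sub>R axis i 1))"
    by (intro has_derivative_frechet test_function_differentiable assms)
  have "((\<lambda>s. x + s *\<^sub>R axis i 1) has_derivative (\<lambda>s. s *\<^sub>R axis i 1)) (at s)"
    by (auto intro!: derivative_eq_intros)
  from has_derivative_compose[OF this phi] show ?thesis
    using linear_scale[OF has_derivative_linear[OF phi], of _ "axis i 1"]
    by (simp add: has_field_derivative_def pd_def mult_commute_abs)
qed

text \<open>Taylor with an explicit remainder; two applications of the mean value inequality suffice.\<close>
lemma second_order_bound:
  fixes f :: "real \<Rightarrow> real"
  assumes f: "\<And>s. (f has_real_derivative f' s) (at s)"
    and f': "\<And>s. (f' has_real_derivative f'' s) (at s)" and C: "\<And>s. \<bar>f'' s\<bar> \<le> C"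
  shows "\<bar>f h - f 0 - h * f' 0\<bar> \<le> C * h\<^sup>2"
proof -
  have "C \<ge> 0" using C[of 0] by linarith
  have f'_bound: "\<bar>f' s - f' 0\<bar> \<le> C * \<bar>s\<bar>" for s
    using field_differentiable_bound[of UNIV f' f'' C s 0] f' C by simp
  let ?S = "{- \<bar>h\<bar>..\<bar>h\<bar>}"
  have "norm ((f h - h * f' 0) - (f 0 - 0 * f' 0)) \<le> C * \<bar>h\<bar> * norm (h - 0)"
  proof (rule field_differentiable_bound[of ?S "\<lambda>s. f s - s * f' 0" "\<lambda>s. f' s - f' 0"])
    show "((\<lambda>s. f s - s * f' 0) has_field_derivative f' s - f' 0) (at s within ?S)" for s
      by (rule has_field_derivative_at_within) (rule derivative_eq_intros f | simp)+
    show "norm (f' s - f' 0) \<le> C * \<bar>h\<bar>" if "s \<in> ?S" for s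
    proof -
      have "\<bar>s\<bar> \<le> \<bar>h\<bar>" using that by auto
      then show ?thesis using f'_bound[of s] mult_left_mono[OF _ \<open>C \<ge> 0\<close>, of "\<bar>s\<bar>" "\<bar>h\<bar>"] by simp
    qed
  qed auto
  moreover have "C * \<bar>h\<bar> * norm (h - 0) = C * h\<^sup>2"
    by (simp add: power2_eq_square)
  moreover have "(f h - h * f' 0) - (f 0 - 0 * f' 0) = f h - f 0 - h * f' 0" by simp
  ultimately show ?thesis unfolding real_norm_def by (simp only:)
qed

text \<open>The remainder is of order \<open>h\<close> uniformly in space, and for small \<open>h\<close> it lives in a fixed compact set, so
  uniform convergence implies convergence in norm.\<close>
lemma diff_quot_test_vector:
  assumes "test_function \<phi>"
  shows "((\<lambda>h. diff_quot i h (test_vector c \<phi>)) \<longlongrightarrow> test_vector c (pd i \<phi>)) (at 0)"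
proof -
  let ?e = "axis i 1 :: real^'a"
  have test': "test_function (pd i \<phi>)" by (rule test_function_pd[OF assms])
  note [measurable] = test_function_measurable[OF assms] test_function_measurable[OF test']
    test_function_measurable[OF test_function_shift[OF assms]]
  obtain C where C: "C > 0" "\<And>x. \<bar>pd i (pd i \<phi>) x\<bar> \<le> C"
    using test_function_bounded[OF test_function_pd[OF test']] by metis
  obtain K1 where K1: "compact K1" "\<And>x. x \<notin> K1 \<Longrightarrow> \<phi> x = 0"
    using assms by (auto simp: test_function_def)
  obtain K2 where K2: "compact K2" "\<And>x. x \<notin> K2 \<Longrightarrow> pd i \<phi> x = 0"
    using test' by (auto simp: test_function_def)
  \<comment> \<open>Contains the supports of all difference quotients with step at most 1.\<close>
  define K where "K = {x + y | x y. x \<in> K1 \<union> K2 \<and> y \<in> cball (0 :: real^'a) 1}"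
  have "compact K" unfolding K_def using K1(1) K2(1) by (intro compact_sums compact_Un compact_cball)
  define \<mu> where "\<mu> = measure lborel K"
  have emK: "emeasure lborel K = ennreal \<mu>"
    using emeasure_compact_finite[OF \<open>compact K\<close>] by (simp add: \<mu>_def emeasure_eq_ennreal_measure)
  have [measurable]: "K \<in> sets borel" using \<open>compact K\<close> by (rule borel_compact)
  have bound: "norm (diff_quot i h (test_vector c \<phi>) - test_vector c (pd i \<phi>)) \<le> \<bar>h\<bar> * (norm c * C * sqrt \<mu>)"
    if h: "h \<noteq> 0" "\<bar>h\<bar> \<le> 1" for h
  proof -
    define r where "r x = (\<phi> (x + h *\<^sub>R ?e) - \<phi> x) / h - pd i \<phi> x" for x
    have r_bound: "\<bar>r x\<bar> \<le> C * \<bar>h\<bar>" for x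
    proof -
      have "\<bar>\<phi> (x + h *\<^sub>R ?e) - \<phi> x - h * pd i \<phi> x\<bar> \<le> C * h\<^sup>2"
        using second_order_bound[OF DERIV_along_axis[OF assms, of x i] DERIV_along_axis[OF test', of x i] C(2), of h]
        by simp
      moreover have "\<phi> (x + h *\<^sub>R ?e) - \<phi> x - h * pd i \<phi> x = h * r x"
        using h by (simp add: r_def field_simps)
      moreover have hh: "h\<^sup>2 = \<bar>h\<bar> * \<bar>h\<bar>" by (simp add: power2_eq_square)
      ultimately have "\<bar>h\<bar> * \<bar>r x\<bar> \<le> \<bar>h\<bar> * (C * \<bar>h\<bar>)"
        using hh by (simp only: abs_mult mult.left_commute[of C])
      then show ?thesis using h by simp
    qed
    have r_support: "r x = 0" if "x \<notin> K" for x
    proof -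
      have "x + y \<notin> K1 \<union> K2" if "norm y \<le> 1" for y
      proof
        assume "x + y \<in> K1 \<union> K2"
        moreover have "x = (x + y) + (- y)" "- y \<in> cball 0 1" using that by auto
        ultimately have "x \<in> K" unfolding K_def by blast
        then show False using \<open>x \<notin> K\<close> by simp
      qed
      from this[of 0] this[of "h *\<^sub>R ?e"] show ?thesis
        using h(2) K1(2) K2(2) by (simp add: r_def)
    qed
    have [measurable]: "r \<in> borel_measurable lborel" unfolding r_def by measurable
    have sq: "square_integrable (\<lambda>x. c * of_real (r x))"
      by (rule square_integrable_if_bounded_support[OF _ \<open>compact K\<close>, of _ "norm c * (C * \<bar>h\<bar>)"])
         (auto simp: norm_mult r_support intro!: mult_left_mono r_bound)
    have sq_phi: "square_integrable (\<lambda>x. c * of_real (\<phi> (x + h *\<^sub>R ?e)))"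
      by (rule square_integrable_test_function[OF test_function_shift[OF assms]])
    note sqs = sq_phi square_integrable_test_function[OF assms] square_integrable_test_function[OF test']
    have "diff_quot i h (test_vector c \<phi>) - test_vector c (pd i \<phi>)
        = abs_L2 (\<lambda>x. inverse h *\<^sub>R (c * of_real (\<phi> (x + h *\<^sub>R ?e)) - c * of_real (\<phi> x)) - c * of_real (pd i \<phi> x))"
      unfolding diff_quot_def translate_test_vector[OF assms] unfolding test_vector_def
      by (subst minus_L2.abs_eq scaleR_L2.abs_eq;
          (simp add: L2_rel_def sqs square_integrable_diff square_integrable_scaleR del: scaleR_conv_of_real)?)+
    also have "\<dots> = abs_L2 (\<lambda>x. c * of_real (r x))"
      by (simp add: r_def scaleR_conv_of_real field_simps)
    finally have eq: "diff_quot i h (test_vector c \<phi>) - test_vector c (pd i \<phi>) = abs_L2 (\<lambda>x. c * of_real (r x))" .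
    have "ennreal ((norm (abs_L2 (\<lambda>x. c * of_real (r x))))\<^sup>2)
        = (\<integral>\<^sup>+x. ennreal ((norm (c * of_real (r x)))\<^sup>2) \<partial>lborel)"
      by (rule nn_norm_abs_L2[OF sq])
    also have "\<dots> \<le> (\<integral>\<^sup>+x. ennreal ((norm c * (C * \<bar>h\<bar>))\<^sup>2) * indicator K x \<partial>lborel)"
    proof (rule nn_integral_mono)
      fix x show "ennreal ((norm (c * of_real (r x)))\<^sup>2) \<le> ennreal ((norm c * (C * \<bar>h\<bar>))\<^sup>2) * indicator K x"
        using r_support[of x] r_bound[of x]
        by (cases "x \<in> K") (auto simp: norm_mult intro!: ennreal_leI power_mono mult_left_mono)
    qed
    also have "\<dots> = ennreal ((norm c * (C * \<bar>h\<bar>))\<^sup>2 * \<mu>)"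
      by (simp add: nn_integral_cmult_indicator emK ennreal_mult \<mu>_def)
    also have "(norm c * (C * \<bar>h\<bar>))\<^sup>2 * \<mu> = (\<bar>h\<bar> * (norm c * C * sqrt \<mu>))\<^sup>2"
      by (simp add: power_mult_distrib \<mu>_def mult_ac)
    finally have "(norm (abs_L2 (\<lambda>x. c * of_real (r x))))\<^sup>2 \<le> (\<bar>h\<bar> * (norm c * C * sqrt \<mu>))\<^sup>2"
      by (subst (asm) ennreal_le_iff) auto
    then show ?thesis unfolding eq
      by (rule power2_le_imp_le) (use C(1) in \<open>auto simp: \<mu>_def\<close>)
  qed
  have "((\<lambda>h. \<bar>h\<bar> * (norm c * C * sqrt \<mu>)) \<longlongrightarrow> \<bar>0\<bar> * (norm c * C * sqrt \<mu>)) (at 0)"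
    by (intro tendsto_intros)
  then have "((\<lambda>h. \<bar>h\<bar> * (norm c * C * sqrt \<mu>)) \<longlongrightarrow> 0) (at 0)" by simp
  moreover have "eventually (\<lambda>h. norm (diff_quot i h (test_vector c \<phi>) - test_vector c (pd i \<phi>))
      \<le> \<bar>h\<bar> * (norm c * C * sqrt \<mu>)) (at 0)"
    unfolding eventually_at using bound by (intro exI[of _ 1]) (auto simp: dist_real_def)
  ultimately have "((\<lambda>h. diff_quot i h (test_vector c \<phi>) - test_vector c (pd i \<phi>)) \<longlongrightarrow> 0) (at 0)"
    by (rule Lim_null_comparison[rotated])
  then show ?thesis by (subst Lim_null)
qed

section \<open>Dirichlet energy as a supremum of difference quotients\<close>

lemma inner_translate_right: "u \<bullet> translate h v = translate (- h) u \<bullet> v"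
  by (simp add: translate_adjoint)

lemma diff_quot_adjoint: "diff_quot i h u \<bullet> v = - (u \<bullet> diff_quot i (- h) v)"
  by (simp add: diff_quot_def inner_diff translate_adjoint)

lemma filterlim_uminus_at_0: "filterlim uminus (at 0) (at (0::real))"
  unfolding filterlim_at by (auto intro!: tendsto_eq_intros simp: eventually_at_filter)

text \<open>Discrete integration by parts is invariance of the integral under translations; the step tends to zero
  on both sides.\<close>
lemma test_vector_integration_by_parts:
  assumes "test_function \<phi>" "test_function \<psi>"
  shows "test_vector c \<phi> \<bullet> test_vector c' (pd i \<psi>) = - (test_vector c (pd i \<phi>) \<bullet> test_vector c' \<psi>)"
proof -
  have "((\<lambda>h. diff_quot i h (test_vector c \<phi>) \<bullet> test_vector c' \<psi>)
      \<longlongrightarrow> test_vector c (pd i \<phi>) \<bullet> test_vector c' \<psi>) (at 0)"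
    by (intro tendsto_intros diff_quot_test_vector assms)
  moreover have "((\<lambda>h. diff_quot i h (test_vector c \<phi>) \<bullet> test_vector c' \<psi>)
      \<longlongrightarrow> - (test_vector c \<phi> \<bullet> test_vector c' (pd i \<psi>))) (at 0)"
    unfolding diff_quot_adjoint
    by (intro tendsto_intros filterlim_compose[OF diff_quot_test_vector filterlim_uminus_at_0] assms)
  ultimately have "test_vector c (pd i \<phi>) \<bullet> test_vector c' \<psi> = - (test_vector c \<phi> \<bullet> test_vector c' (pd i \<psi>))"
    using tendsto_unique trivial_limit_at by blast
  then show ?thesis by simp
qed

lemma has_weak_pd_iff_inner:
  "has_weak_pd i u v \<longleftrightarrow> (\<forall>c \<phi>. test_function \<phi> \<longrightarrow> u \<bullet> test_vector c (pd i \<phi>) = - (v \<bullet> test_vector c \<phi>))"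
proof -
  have "((\<integral>x. pd i \<phi> x *\<^sub>R fn u x \<partial>lborel) = - (\<integral>x. \<phi> x *\<^sub>R fn v x \<partial>lborel))
    \<longleftrightarrow> (\<forall>c. u \<bullet> test_vector c (pd i \<phi>) = - (v \<bullet> test_vector c \<phi>))" if "test_function \<phi>" for \<phi>
    unfolding inner_test_vector[OF that] inner_test_vector[OF test_function_pd[OF that]]
    by (subst complex_eq_iff_all_Re) simp
  then show ?thesis unfolding has_weak_pd_def by blast
qed

lemma norm_le_if_dense_inner_le:
  fixes w :: "'a::real_inner"
  assumes "closure V = UNIV" and "0 \<le> B" and le: "\<And>\<Phi>. \<Phi> \<in> V \<Longrightarrow> \<bar>w \<bullet> \<Phi>\<bar> \<le> B * norm \<Phi>"
  shows "norm w \<le> B"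
proof (cases "w = 0")
  case False
  have "w \<in> closure V" using assms(1) by simp
  then obtain X where X: "\<And>n. X n \<in> V" "X \<longlonglongrightarrow> w" by (auto simp: closure_sequential)
  have "\<bar>w \<bullet> w\<bar> \<le> B * norm w"
  proof (rule LIMSEQ_le)
    show "(\<lambda>n. \<bar>w \<bullet> X n\<bar>) \<longlonglongrightarrow> \<bar>w \<bullet> w\<bar>" "(\<lambda>n. B * norm (X n)) \<longlonglongrightarrow> B * norm w"
      by (intro tendsto_intros X(2))+
    show "\<exists>N. \<forall>n\<ge>N. \<bar>w \<bullet> X n\<bar> \<le> B * norm (X n)" using le[OF X(1)] by blast
  qed
  then have "norm w * norm w \<le> B * norm w" by (simp add: dot_square_norm power2_eq_square)
  then show ?thesis using False by simp
qed (use assms(2) in simp)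

text \<open>The vectors \<open>\<Phi>\<close> in the domain of the derivative in direction \<open>i\<close>, understood as the generator of
  the translation group, for which the formula of partial integration between \<open>u\<close> and \<open>v\<close> holds along
  the whole orbit. If \<open>v\<close> is the weak derivative of \<open>u\<close> these include the test vectors, and they always
  form a subspace that allows differentiation along translates.\<close>
definition parts_domain :: "'d \<Rightarrow> 'd::finite L2 \<Rightarrow> 'd L2 \<Rightarrow> 'd L2 set"
  where "parts_domain i u v = {\<Phi>. \<exists>\<Phi>'. ((\<lambda>h. diff_quot i h \<Phi>) \<longlongrightarrow> \<Phi>') (at 0) \<and>
    (\<forall>s. u \<bullet> translate (s *\<^sub>R axis i 1) \<Phi>' = - (v \<bullet> translate (s *\<^sub>R axis i 1) \<Phi>))}"

lemma diff_quot_add: "diff_quot i h (u + v) = diff_quot i h u + diff_quot i h v"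
  by (simp add: diff_quot_def translate_add scaleR_add_right[symmetric] add_diff_add)

lemma diff_quot_scaleR: "diff_quot i h (c *\<^sub>R u) = c *\<^sub>R diff_quot i h u"
  by (simp add: diff_quot_def translate_scaleR scaleR_diff_right[symmetric] scaleR_left_commute)

lemma diff_quot_zero [simp]: "diff_quot i h 0 = 0"
  using diff_quot_scaleR[of i h 0 0] by simp

lemma translate_zero_L2 [simp]: "translate h 0 = 0"
  using translate_scaleR[of h 0 0] by simp

lemma subspace_parts_domain: "subspace (parts_domain i u v)"
  unfolding subspace_def
proof (intro conjI ballI allI)
  show "0 \<in> parts_domain i u v"
    by (auto simp: parts_domain_def intro!: exI[of _ 0])
  show "x + y \<in> parts_domain i u v" if xy: "x \<in> parts_domain i u v" "y \<in> parts_domain i u v" for x y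
  proof -
    obtain x' y' where
      "((\<lambda>h. diff_quot i h x) \<longlongrightarrow> x') (at 0)" "((\<lambda>h. diff_quot i h y) \<longlongrightarrow> y') (at 0)"
      "\<And>s. u \<bullet> translate (s *\<^sub>R axis i 1) x' = - (v \<bullet> translate (s *\<^sub>R axis i 1) x)"
      "\<And>s. u \<bullet> translate (s *\<^sub>R axis i 1) y' = - (v \<bullet> translate (s *\<^sub>R axis i 1) y)"
      using xy unfolding parts_domain_def by blast
    then show ?thesis unfolding parts_domain_def
      by (auto simp: diff_quot_add translate_add inner_add_right intro!: exI[of _ "x' + y'"] tendsto_add)
  qed
  show "c *\<^sub>R x \<in> parts_domain i u v" if x: "x \<in> parts_domain i u v" for c x
  proof -
    obtain x' where
      "((\<lambda>h. diff_quot i h x) \<longlongrightarrow> x') (at 0)"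
      "\<And>s. u \<bullet> translate (s *\<^sub>R axis i 1) x' = - (v \<bullet> translate (s *\<^sub>R axis i 1) x)"
      using x unfolding parts_domain_def by blast
    then show ?thesis unfolding parts_domain_def
      by (auto simp: diff_quot_scaleR translate_scaleR intro!: exI[of _ "c *\<^sub>R x'"] tendsto_scaleR)
  qed
qed

lemma test_vector_in_parts_domain:
  assumes "has_weak_pd i u v" "test_function \<phi>"
  shows "test_vector c \<phi> \<in> parts_domain i u v"
proof -
  have "u \<bullet> translate a (test_vector c (pd i \<phi>)) = - (v \<bullet> translate a (test_vector c \<phi>))" for a
  proof -
    have "pd i (\<lambda>x. \<phi> (x + a)) = (\<lambda>x. pd i \<phi> (x + a))"
      by (rule pd_shift) (rule test_function_differentiable[OF assms(2)])
    moreover have "u \<bullet> test_vector c (pd i (\<lambda>x. \<phi> (x + a))) = - (v \<bullet> test_vector c (\<lambda>x. \<phi> (x + a)))"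
      using assms(1) test_function_shift[OF assms(2), of a] unfolding has_weak_pd_iff_inner by blast
    ultimately show ?thesis
      by (simp only: translate_test_vector assms(2) test_function_pd)
  qed
  then show ?thesis
    unfolding parts_domain_def using diff_quot_test_vector[OF assms(2)] by blast
qed

lemma closure_parts_domain:
  assumes "has_weak_pd i u v" shows "closure (parts_domain i u v) = UNIV"
  by (rule closure_eq_UNIV_if_separating[OF subspace_parts_domain])
     (intro test_vectors_separate, use test_vector_in_parts_domain[OF assms] in blast)

text \<open>By duality it suffices to bound \<open>(u(\<cdot> + h) - u) \<bullet> \<Phi> = u \<bullet> (\<Phi>(\<cdot> - h) - \<Phi>)\<close>. The derivative of
  \<open>s \<mapsto> u \<bullet> \<Phi>(\<cdot> + s)\<close> is \<open>- v \<bullet> \<Phi>(\<cdot> + s)\<close> by partial integration, and is bounded by \<open>|v| |\<Phi>|\<close>.\<close>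
lemma norm_diff_quot_le:
  assumes "has_weak_pd i u v" shows "norm (diff_quot i h u) \<le> norm v"
proof (rule norm_le_if_dense_inner_le[OF closure_parts_domain[OF assms]])
  fix \<Phi> assume "\<Phi> \<in> parts_domain i u v"
  then obtain \<Phi>' where lim: "((\<lambda>h. diff_quot i h \<Phi>) \<longlongrightarrow> \<Phi>') (at 0)"
    and parts: "\<And>s. u \<bullet> translate (s *\<^sub>R axis i 1) \<Phi>' = - (v \<bullet> translate (s *\<^sub>R axis i 1) \<Phi>)"
    unfolding parts_domain_def by blast
  define g where "g s = u \<bullet> translate (s *\<^sub>R axis i 1) \<Phi>" for s
  define g' where "g' s = - (v \<bullet> translate (s *\<^sub>R axis i 1) \<Phi>)" for s
  have der: "(g has_real_derivative g' s) (at s)" for s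
  proof -
    have quot: "(g (s + t) - g s) / t = translate (- (s *\<^sub>R axis i 1)) u \<bullet> diff_quot i t \<Phi>" for t
      by (simp add: g_def diff_quot_def inner_translate_right inner_diff_right translate_translate
          scaleR_add_left divide_inverse mult.commute flip: translate_adjoint)
        (simp add: translate_adjoint translate_translate add.commute)
    have "((\<lambda>t. translate (- (s *\<^sub>R axis i 1)) u \<bullet> diff_quot i t \<Phi>)
        \<longlongrightarrow> translate (- (s *\<^sub>R axis i 1)) u \<bullet> \<Phi>') (at 0)"
      by (intro tendsto_intros lim)
    moreover have "translate (- (s *\<^sub>R axis i 1)) u \<bullet> \<Phi>' = g' s"
      using parts[of s] by (simp add: g'_def translate_adjoint)
    ultimately show ?thesis unfolding DERIV_def quot by simp
  qed
  have g'_bound: "norm (g' s) \<le> norm v * norm \<Phi>" for s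
    using Cauchy_Schwarz_ineq2[of v "translate (s *\<^sub>R axis i 1) \<Phi>"] by (simp add: g'_def)
  have "norm (g (- h) - g 0) \<le> norm v * norm \<Phi> * norm (- h - 0)"
    by (rule field_differentiable_bound[of UNIV]) (use der g'_bound in auto)
  moreover have "g (- h) - g 0 = h * (diff_quot i h u \<bullet> \<Phi>)" 
    by (cases "h = 0") (simp_all add: g_def diff_quot_def inner_diff translate_adjoint)
  ultimately have bound: "\<bar>h\<bar> * \<bar>diff_quot i h u \<bullet> \<Phi>\<bar> \<le> \<bar>h\<bar> * (norm v * norm \<Phi>)"
    by (simp add: abs_mult mult.commute)
  show "\<bar>diff_quot i h u \<bullet> \<Phi>\<bar> \<le> norm v * norm \<Phi>"
    using bound by (cases "h = 0") (auto simp: diff_quot_def)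
qed simp

lemma dyadic_tendsto_0: "filterlim (\<lambda>n. (1/2) ^ n) (at (0::real)) sequentially"
  unfolding filterlim_at by (auto intro!: LIMSEQ_realpow_zero)

abbreviation dyadic_quot :: "'d \<Rightarrow> nat \<Rightarrow> 'd::finite L2 \<Rightarrow> 'd L2"
  where "dyadic_quot i n \<equiv> diff_quot i ((1/2) ^ n)"

lemma inner_dyadic_quot_tendsto:
  assumes "((\<lambda>h. diff_quot i h \<Phi>) \<longlongrightarrow> \<Phi>') (at 0)"
  shows "(\<lambda>n. dyadic_quot i n u \<bullet> \<Phi>) \<longlonglongrightarrow> - (u \<bullet> \<Phi>')"
  unfolding diff_quot_adjoint
  by (intro tendsto_intros filterlim_compose[OF assms]
      filterlim_compose[OF filterlim_uminus_at_0 dyadic_tendsto_0])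

lemma norm_weak_pd_le:
  assumes "has_weak_pd i u v" and M: "\<And>n. norm (dyadic_quot i n u) \<le> M"
  shows "norm v \<le> M"
proof (rule norm_le_if_dense_inner_le[OF closure_parts_domain[OF assms(1)]])
  show "0 \<le> M" using M[of 0] norm_ge_zero order_trans by blast
  fix \<Phi> assume "\<Phi> \<in> parts_domain i u v"
  then obtain \<Phi>' where lim: "((\<lambda>h. diff_quot i h \<Phi>) \<longlongrightarrow> \<Phi>') (at 0)"
    and parts: "\<And>s. u \<bullet> translate (s *\<^sub>R axis i 1) \<Phi>' = - (v \<bullet> translate (s *\<^sub>R axis i 1) \<Phi>)"
    unfolding parts_domain_def by blast
  show "\<bar>v \<bullet> \<Phi>\<bar> \<le> M * norm \<Phi>"
  proof (rule LIMSEQ_le_const2)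
    show "(\<lambda>n. \<bar>dyadic_quot i n u \<bullet> \<Phi>\<bar>) \<longlonglongrightarrow> \<bar>v \<bullet> \<Phi>\<bar>"
      using tendsto_rabs[OF inner_dyadic_quot_tendsto[OF lim, of u]] parts[of 0] by simp
    have "\<bar>dyadic_quot i n u \<bullet> \<Phi>\<bar> \<le> M * norm \<Phi>" for n
      using Cauchy_Schwarz_ineq2[of "dyadic_quot i n u" \<Phi>] mult_right_mono[OF M[of n] norm_ge_zero[of \<Phi>]]
      by linarith
    then show "\<exists>N. \<forall>n\<ge>N. \<bar>dyadic_quot i n u \<bullet> \<Phi>\<bar> \<le> M * norm \<Phi>" by blast
  qed
qed

text \<open>Against a test vector the quotients converge to the distributional derivative, so their weak limit
  represents it.\<close>
lemma bounded_dyadic_quot_imp_weak_pd: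
  assumes "\<And>n. norm (dyadic_quot i n u) \<le> M" shows "\<exists>v. has_weak_pd i u v"
proof -
  obtain v where v: "\<And>w c. (\<lambda>n. dyadic_quot i n u \<bullet> w) \<longlonglongrightarrow> c \<Longrightarrow> v \<bullet> w = c"
    using bounded_sequence_weak_limit[of "\<lambda>n. dyadic_quot i n u" M] assms by metis
  have "u \<bullet> test_vector c (pd i \<phi>) = - (v \<bullet> test_vector c \<phi>)" if "test_function \<phi>" for c \<phi>
    using v[OF inner_dyadic_quot_tendsto[OF diff_quot_test_vector[OF that]]] by simp
  then show ?thesis unfolding has_weak_pd_iff_inner by blast
qed

lemma has_weak_pd_unique:
  assumes "has_weak_pd i u v" "has_weak_pd i u w" shows "v = w"
proof -
  have "v - w = 0"
    by (rule test_vectors_separate)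
       (use assms in \<open>auto simp: has_weak_pd_iff_inner inner_diff_left\<close>)
  then show ?thesis by simp
qed

text \<open>The quotient with the doubled step is the mean of the quotient with the single step and its translate.\<close>
lemma norm_dyadic_quot_Suc: "norm (dyadic_quot i n u) \<le> norm (dyadic_quot i (Suc n) u)"
proof -
  define h :: real where "h = (1/2) ^ Suc n"
  let ?t = "translate (h *\<^sub>R axis i 1)"
  have "h \<noteq> 0" and double: "(1/2) ^ n = 2 * h" by (simp_all add: h_def)
  have "?t (?t u) = translate ((2 * h) *\<^sub>R axis i 1) u"
    by (simp add: translate_translate scaleR_add_left[symmetric])
  then have "dyadic_quot i n u = (1/2) *\<^sub>R (?t (diff_quot i h u) + diff_quot i h u)"
    unfolding double diff_quot_def using \<open>h \<noteq> 0\<close>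
    by (simp add: translate_scaleR translate_diff flip: scaleR_add_right)
  then have "norm (dyadic_quot i n u) \<le> (1/2) * (norm (?t (diff_quot i h u)) + norm (diff_quot i h u))"
    using norm_triangle_ineq[of "?t (diff_quot i h u)" "diff_quot i h u"] by simp
  then show ?thesis by (simp add: h_def)
qed

lemma SUP_dyadic_quot_weak_pd:
  assumes "has_weak_pd i u v"
  shows "(SUP n. ennreal ((norm (dyadic_quot i n u))\<^sup>2)) = ennreal ((norm v)\<^sup>2)"
proof (rule antisym)
  show "(SUP n. ennreal ((norm (dyadic_quot i n u))\<^sup>2)) \<le> ennreal ((norm v)\<^sup>2)"
    by (intro SUP_least ennreal_leI power_mono norm_diff_quot_le[OF assms]) simp
  have least: "ennreal ((norm v)\<^sup>2) \<le> B" if B: "\<And>n. ennreal ((norm (dyadic_quot i n u))\<^sup>2) \<le> B" for B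
  proof (cases B)
    case (real b)
    have "norm (dyadic_quot i n u) \<le> sqrt b" for n
      using B[of n] real by (intro real_le_rsqrt) (simp add: ennreal_le_iff)
    then have "norm v \<le> sqrt b" by (rule norm_weak_pd_le[OF assms])
    then have "(norm v)\<^sup>2 \<le> b" using real(1) power_mono[of "norm v" "sqrt b" 2] by simp
    then show ?thesis using real by (simp add: ennreal_leI)
  qed simp
  show "ennreal ((norm v)\<^sup>2) \<le> (SUP n. ennreal ((norm (dyadic_quot i n u))\<^sup>2))"
    by (rule least) (rule SUP_upper, simp)
qed

lemma SUP_dyadic_quot_finite_imp_weak_pd:
  assumes "(SUP n. ennreal ((norm (dyadic_quot i n u))\<^sup>2)) < \<infinity>"
  shows "\<exists>v. has_weak_pd i u v"
proof -
  obtain b where b: "b \<ge> 0" "(SUP n. ennreal ((norm (dyadic_quot i n u))\<^sup>2)) = ennreal b"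
    using assms by (cases "SUP n. ennreal ((norm (dyadic_quot i n u))\<^sup>2)") auto
  have "norm (dyadic_quot i n u) \<le> sqrt b" for n
  proof (rule real_le_rsqrt)
    have "ennreal ((norm (dyadic_quot i n u))\<^sup>2) \<le> ennreal b" unfolding b(2)[symmetric] by (rule SUP_upper) simp
    then show "(norm (dyadic_quot i n u))\<^sup>2 \<le> b" using b(1) by (simp add: ennreal_le_iff)
  qed
  then show ?thesis by (rule bounded_dyadic_quot_imp_weak_pd)
qed

definition dyadic_energy :: "nat \<Rightarrow> 'd::finite L2 \<Rightarrow> ennreal"
  where "dyadic_energy n u = (\<Sum>i\<in>UNIV. ennreal ((norm (dyadic_quot i n u))\<^sup>2))"

lemma incseq_norm_dyadic_quot: "incseq (\<lambda>n. ennreal ((norm (dyadic_quot i n u))\<^sup>2))"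
  by (intro incseq_SucI ennreal_leI power_mono norm_dyadic_quot_Suc) simp

lemma incseq_dyadic_energy: "incseq (\<lambda>n. dyadic_energy n u)"
  unfolding dyadic_energy_def
  by (intro incseq_SucI sum_mono incseq_SucD[OF incseq_norm_dyadic_quot])

lemma SUP_dyadic_energy_eq_sum:
  "(SUP n. dyadic_energy n u) = (\<Sum>i\<in>UNIV. SUP n. ennreal ((norm (dyadic_quot i n u))\<^sup>2))"
  unfolding dyadic_energy_def by (rule ennreal_SUP_sum[OF incseq_norm_dyadic_quot])

text \<open>The supremum commutes with the sum over the directions because the quotients increase in each direction.
  Outside \<open>H\<^sup>1\<close> both sides are infinite.\<close>
lemma grad_normsq_eq_SUP: "grad_normsq u = (SUP n. dyadic_energy n u)"
proof (cases "u \<in> H1")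
  case True
  then have "\<exists>v. \<forall>i. has_weak_pd i u (v i)" unfolding H1_def by (simp add: choice_iff)
  then obtain v where v: "\<And>i. has_weak_pd i u (v i)" by blast
  have the: "(THE w. has_weak_pd i u w) = v i" for i
    using v has_weak_pd_unique by (intro the_equality) blast+
  have "grad_normsq u = (\<integral>\<^sup>+x. (\<Sum>i\<in>UNIV. ennreal ((norm (fn (v i) x))\<^sup>2)) \<partial>lborel)"
    using True by (simp add: grad_normsq_def grad_def the norm_vec_def L2_set_def sum_nonneg sum_ennreal)
  also have "\<dots> = (\<Sum>i\<in>UNIV. ennreal ((norm (v i))\<^sup>2))"
    by (subst nn_integral_sum) (simp_all add: nn_norm_fn)
  also have "\<dots> = (SUP n. dyadic_energy n u)"
    unfolding SUP_dyadic_energy_eq_sum by (simp add: SUP_dyadic_quot_weak_pd[OF v])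
  finally show ?thesis .
next
  case False
  then obtain i where "\<not> (\<exists>v. has_weak_pd i u v)" unfolding H1_def by blast
  then have "(SUP n. ennreal ((norm (dyadic_quot i n u))\<^sup>2)) = \<infinity>"
    using SUP_dyadic_quot_finite_imp_weak_pd[of i u] unfolding infinity_ennreal_def
    by (meson top.not_eq_extremum)
  then have "(SUP n. dyadic_energy n u) = \<infinity>"
    unfolding SUP_dyadic_energy_eq_sum by auto
  then show ?thesis using False unfolding grad_normsq_def by (simp only: if_False)
qed

section \<open>The group commutes with translations\<close>

lemma integrable_test_function_fn:
  assumes "test_function \<phi>" shows "integrable lborel (\<lambda>x. \<phi> x *\<^sub>R fn u x)"
  using square_integrable_mult_cnj[OF square_integrable_fn[of u] square_integrable_test_function[OF assms, of 1]]
  by (simp add: scaleR_conv_of_real mult.commute)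

lemma inner_laplacian_test_vector:
  assumes "test_function \<phi>"
  shows "u \<bullet> (\<Sum>i\<in>UNIV. test_vector c (pd i (pd i \<phi>))) = Re (cnj c * (\<integral>x. laplacian \<phi> x *\<^sub>R fn u x \<partial>lborel))"
proof -
  have "(\<integral>x. laplacian \<phi> x *\<^sub>R fn u x \<partial>lborel) = (\<Sum>i\<in>UNIV. \<integral>x. pd i (pd i \<phi>) x *\<^sub>R fn u x \<partial>lborel)"
    unfolding laplacian_def scaleR_sum_left
    by (intro Bochner_Integration.integral_sum integrable_test_function_fn test_function_pd assms)
  then show ?thesis
    by (simp only: inner_sum_right inner_test_vector test_function_pd assms sum_distrib_left Re_sum)
qed

lemma has_weak_laplacian_iff_inner:
  "has_weak_laplacian u w \<longleftrightarrow> (\<forall>c \<phi>. test_function \<phi> \<longrightarrow>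
    u \<bullet> (\<Sum>i\<in>UNIV. test_vector c (pd i (pd i \<phi>))) = w \<bullet> test_vector c \<phi>)"
proof -
  have "((\<integral>x. laplacian \<phi> x *\<^sub>R fn u x \<partial>lborel) = (\<integral>x. \<phi> x *\<^sub>R fn w x \<partial>lborel))
    \<longleftrightarrow> (\<forall>c. u \<bullet> (\<Sum>i\<in>UNIV. test_vector c (pd i (pd i \<phi>))) = w \<bullet> test_vector c \<phi>)"
    if "test_function \<phi>" for \<phi>
    unfolding inner_test_vector[OF that] inner_laplacian_test_vector[OF that]
    by (rule complex_eq_iff_all_Re)
  then show ?thesis unfolding has_weak_laplacian_def by blast
qed

lemma has_weak_laplacian_test_vector:
  assumes "test_function \<phi>"
  shows "has_weak_laplacian (test_vector c \<phi>) (\<Sum>i\<in>UNIV. test_vector c (pd i (pd i \<phi>)))"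
  unfolding has_weak_laplacian_iff_inner inner_sum_right inner_sum_left
  by (simp add: test_vector_integration_by_parts test_function_pd assms)

text \<open>Dually, the Laplacian of a translated test function is the translate of its Laplacian.\<close>
lemma has_weak_laplacian_translate:
  assumes "has_weak_laplacian u w" shows "has_weak_laplacian (translate h u) (translate h w)"
  unfolding has_weak_laplacian_iff_inner
proof (intro allI impI)
  fix c and \<phi> :: "real^'a \<Rightarrow> real" assume phi: "test_function \<phi>"
  let ?\<psi> = "\<lambda>x. \<phi> (x + - h)"
  have psi: "test_function ?\<psi>" by (rule test_function_shift[OF phi])
  have pd_psi: "pd i (pd i ?\<psi>) = (\<lambda>x. pd i (pd i \<phi>) (x + - h))" for i
    by (simp only: pd_shift test_function_differentiable test_function_pd phi)
  have "translate h u \<bullet> (\<Sum>i\<in>UNIV. test_vector c (pd i (pd i \<phi>)))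
      = u \<bullet> (\<Sum>i\<in>UNIV. test_vector c (pd i (pd i ?\<psi>)))"
    unfolding inner_sum_right pd_psi
    by (simp only: translate_adjoint translate_test_vector test_function_pd phi)
  also have "\<dots> = w \<bullet> test_vector c ?\<psi>"
    using assms psi unfolding has_weak_laplacian_iff_inner by blast
  also have "\<dots> = translate h w \<bullet> test_vector c \<phi>"
    by (simp only: translate_adjoint translate_test_vector phi)
  finally show "translate h u \<bullet> (\<Sum>i\<in>UNIV. test_vector c (pd i (pd i \<phi>))) = translate h w \<bullet> test_vector c \<phi>" .
qed

lemma minus_i_Laplacian_translate:
  "minus_i_Laplacian u v \<Longrightarrow> minus_i_Laplacian (translate h u) (translate h v)"
  unfolding minus_i_Laplacian_def using has_weak_laplacian_translate translate_mulC by metis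


lemma tendsto_linear_isometry:
  fixes L :: "'a::real_normed_vector \<Rightarrow> 'b::real_normed_vector"
  assumes diff: "\<And>u v. L (u - v) = L u - L v" and norm: "\<And>u. norm (L u) = norm u"
    and f: "(f \<longlongrightarrow> l) F"
  shows "((\<lambda>x. L (f x)) \<longlongrightarrow> L l) F"
proof -
  have "dist (L u) (L v) = dist u v" for u v
    by (simp add: dist_norm norm flip: diff)
  then show ?thesis using f unfolding tendsto_iff by simp
qed

lemma scaleR_eq_mulC: "r *\<^sub>R u = of_real r *\<^sub>C u"
  by transfer (simp add: L2_rel_def square_integrable_scaleR square_integrable_cmult scaleR_conv_of_real)

context
  fixes U :: "'d::finite L2 \<Rightarrow> 'd L2"
  assumes U: "unitary U"
begin

lemma unitary_add: "U (u + v) = U u + U v"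
  using U by (simp add: unitary_def)

lemma unitary_mulC: "U (c *\<^sub>C u) = c *\<^sub>C U u"
  using U by (simp add: unitary_def)

lemma unitary_norm: "norm (U u) = norm u"
  using U by (simp add: unitary_def)

lemma unitary_scaleR: "U (r *\<^sub>R u) = r *\<^sub>R U u"
  unfolding scaleR_eq_mulC by (rule unitary_mulC)

lemma unitary_diff: "U (u - v) = U u - U v"
  using unitary_add[of u "(-1) *\<^sub>R v"] unitary_scaleR[of "-1" v] by simp

lemma unitary_inner: "U u \<bullet> U v = u \<bullet> v"
  by (simp add: dot_norm unitary_norm flip: unitary_add)

end

context
  fixes S :: "real \<Rightarrow> 'd::finite L2 \<Rightarrow> 'd L2"
  assumes S: "unitary_group S"
begin

lemma group_unitary: "unitary (S t)"
  using S by (simp add: unitary_group_def)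

lemma group_compose: "S (s + t) u = S s (S t u)"
  using S by (simp add: unitary_group_def)

lemma group_0: "S 0 u = u"
  using S by (simp add: unitary_group_def)

lemma group_adjoint: "S t u \<bullet> v = u \<bullet> S (- t) v"
  using unitary_inner[OF group_unitary[of "- t"], of "S t u" v] group_compose[of "- t" t u]
  by (simp add: group_0)

lemma group_tendsto_0: "((\<lambda>h. S h u) \<longlongrightarrow> u) (at 0)"
proof -
  have "continuous_on UNIV (\<lambda>t. S t u)" using S by (simp add: unitary_group_def)
  then have "isCont (\<lambda>t. S t u) 0" by (simp add: continuous_on_eq_continuous_at)
  then show ?thesis by (simp add: isCont_def group_0)
qed

lemma group_quotient_shift: "(S (t + h) u - S t u) /\<^sub>R h = S t ((S h u - u) /\<^sub>R h)"
  by (simp add: group_compose unitary_diff[OF group_unitary] unitary_scaleR[OF group_unitary])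

lemma group_tendsto: "(f \<longlongrightarrow> l) F \<Longrightarrow> ((\<lambda>x. S t (f x)) \<longlongrightarrow> S t l) F"
  by (rule tendsto_linear_isometry[OF unitary_diff unitary_norm]) (rule group_unitary)+

context
  fixes A
  assumes A: "generates A S"
begin

lemma generator_tendsto: "A u v \<Longrightarrow> ((\<lambda>h. (S h u - u) /\<^sub>R h) \<longlongrightarrow> v) (at 0)"
  using A by (simp add: generates_def)

lemma generator_group: "A u v \<Longrightarrow> A (S t u) (S t v)"
proof -
  assume "A u v"
  then have "((\<lambda>h. (S (t + h) u - S t u) /\<^sub>R h) \<longlongrightarrow> S t v) (at 0)"
    unfolding group_quotient_shift by (intro group_tendsto generator_tendsto)
  then have "((\<lambda>h. (S h (S t u) - S t u) /\<^sub>R h) \<longlongrightarrow> S t v) (at 0)"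
    by (simp flip: group_compose add: add.commute)
  then show ?thesis using A by (simp add: generates_def)
qed

lemma generator_diff: "A u v \<Longrightarrow> A u' v' \<Longrightarrow> A (u - u') (v - v')"
proof -
  assume "A u v" "A u' v'"
  then have "((\<lambda>h. (S h u - u) /\<^sub>R h - (S h u' - u') /\<^sub>R h) \<longlongrightarrow> v - v') (at 0)"
    by (intro tendsto_diff generator_tendsto)
  moreover have "(S h u - u) /\<^sub>R h - (S h u' - u') /\<^sub>R h = (S h (u - u') - (u - u')) /\<^sub>R h" for h
    by (simp add: unitary_diff[OF group_unitary] algebra_simps)
  ultimately show ?thesis using A by (simp add: generates_def)
qed

text \<open>The norm of \<open>S(h) u\<close> does not depend on \<open>h\<close>; differentiate its square at zero.\<close>
lemma generator_skew:
  assumes "A u v" shows "v \<bullet> u = 0"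
proof -
  have "((\<lambda>h. ((S h u - u) /\<^sub>R h) \<bullet> (S h u + u)) \<longlongrightarrow> v \<bullet> (u + u)) (at 0)"
    by (intro tendsto_intros generator_tendsto assms group_tendsto_0)
  moreover have "((S h u - u) /\<^sub>R h) \<bullet> (S h u + u) = 0" for h
    using unitary_inner[OF group_unitary[of h], of u u]
    by (simp add: inner_add inner_diff inner_commute)
  ultimately have "((\<lambda>h::real. 0) \<longlongrightarrow> v \<bullet> (u + u)) (at 0)" by (simp only:)
  then have "v \<bullet> (u + u) = 0" by (simp only: tendsto_const_iff[OF trivial_limit_at])
  then show ?thesis by (simp add: inner_add)
qed

text \<open>Uniqueness for the Cauchy problem: \<open>w(t) = T S(t) u - S(t) T u\<close> solves \<open>w' = A w\<close> with \<open>w(0) = 0\<close>, and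
  its norm is constant since \<open>A\<close> is skew.\<close>
lemma group_commutes_on_domain:
  assumes T: "\<And>u v. A u v \<Longrightarrow> A (T u) (T v)"
    and diff: "\<And>u v. T (u - v) = T u - T v" and scale: "\<And>r u. T (r *\<^sub>R u) = r *\<^sub>R T u"
    and norm: "\<And>u. norm (T u) = norm u"
    and "A u v"
  shows "T (S t u) = S t (T u)"
proof -
  define w where "w t = T (S t u) - S t (T u)" for t
  define w' where "w' t = T (S t v) - S t (T v)" for t
  have Aw: "A (w t) (w' t)" for t
    unfolding w_def w'_def by (intro generator_diff T generator_group \<open>A u v\<close>)
  have quot: "((\<lambda>h. (w (t + h) - w t) /\<^sub>R h) \<longlongrightarrow> w' t) (at 0)" for t
  proof -
    have "(w (t + h) - w t) /\<^sub>R h = T (S t ((S h u - u) /\<^sub>R h)) - S t ((S h (T u) - T u) /\<^sub>R h)" for h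
      unfolding group_quotient_shift[symmetric] w_def by (simp add: diff scale algebra_simps)
    then show ?thesis
      unfolding w'_def
      by (simp only:) (intro tendsto_diff tendsto_linear_isometry[OF diff norm] group_tendsto
          generator_tendsto T \<open>A u v\<close>)
  qed
  have "((\<lambda>t. w t \<bullet> w t) has_real_derivative 0) (at t)" for t
  proof -
    \<comment> \<open>The quotient of \<open>|w|\<^sup>2\<close>, factored as a difference of squares with \<open>w(t + h)\<close> written as \<open>w(t)\<close> plus \<open>h\<close> times the quotient.\<close>
    have "((\<lambda>h. ((w (t + h) - w t) /\<^sub>R h) \<bullet> (h *\<^sub>R ((w (t + h) - w t) /\<^sub>R h) + 2 *\<^sub>R w t))
        \<longlongrightarrow> w' t \<bullet> (0 *\<^sub>R w' t + 2 *\<^sub>R w t)) (at 0)"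
      by (intro tendsto_intros quot)
    then have "((\<lambda>h. ((w (t + h) - w t) /\<^sub>R h) \<bullet> (h *\<^sub>R ((w (t + h) - w t) /\<^sub>R h) + 2 *\<^sub>R w t)) \<longlongrightarrow> 0) (at 0)"
      using generator_skew[OF Aw[of t]] by simp
    moreover have "eventually (\<lambda>h. ((w (t + h) - w t) /\<^sub>R h) \<bullet> (h *\<^sub>R ((w (t + h) - w t) /\<^sub>R h) + 2 *\<^sub>R w t)
        = (w (t + h) \<bullet> w (t + h) - w t \<bullet> w t) / h) (at 0)"
      unfolding eventually_at_filter
      by (auto intro!: always_eventually
          simp: inner_add inner_diff inner_commute scaleR_2 field_simps)
    ultimately show ?thesis unfolding DERIV_def by (rule Lim_transform_eventually)
  qed
  then have "w t \<bullet> w t = w 0 \<bullet> w 0" by (intro DERIV_const_ratio_const2 DERIV_isconst_all) auto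
  then show ?thesis by (simp add: w_def group_0)
qed

end
end

text \<open>On test vectors, which lie in the domain of the generator, this is the preceding uniqueness
  argument. Moving both operators to the test vector by taking adjoints extends it to all of \<open>L\<^sup>2\<close>.\<close>
lemma schroedinger_group_translate:
  assumes "schroedinger_group S"
  shows "S t (translate a u) = translate a (S t u)"
proof -
  have S: "unitary_group S" and A: "generates minus_i_Laplacian S"
    using assms by (simp_all add: schroedinger_group_def)
  have "translate a (S t u) - S t (translate a u) = 0"
  proof (rule test_vectors_separate)
    fix c and \<phi> :: "real^'a \<Rightarrow> real" assume phi: "test_function \<phi>"
    let ?\<Phi> = "test_vector c \<phi>"
    have "\<exists>v. minus_i_Laplacian ?\<Phi> v"
      using has_weak_laplacian_test_vector[OF phi] unfolding minus_i_Laplacian_def by blast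
    then have "translate (- a) (S (- t) ?\<Phi>) = S (- t) (translate (- a) ?\<Phi>)"
      using group_commutes_on_domain[OF S A minus_i_Laplacian_translate translate_diff
          translate_scaleR norm_translate] by blast
    then show "(translate a (S t u) - S t (translate a u)) \<bullet> ?\<Phi> = 0"
      by (simp add: inner_diff_left translate_adjoint group_adjoint[OF S])
  qed
  then show ?thesis by simp
qed

lemma diff_quot_schroedinger_group:
  assumes "schroedinger_group S"
  shows "diff_quot i h (S t u) = S t (diff_quot i h u)"
proof -
  have "unitary (S t)" using assms by (simp add: schroedinger_group_def group_unitary)
  then show ?thesis
    by (simp add: diff_quot_def schroedinger_group_translate[OF assms, symmetric]
        unitary_diff unitary_scaleR)
qed

section \<open>Orthonormal expansions\<close>

context
  fixes e :: "nat \<Rightarrow> 'h::real_inner"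
  assumes e: "orthonormal_basis e"
begin

text \<open>The partial sums are contractions and eventually fix each vector of the span, which is dense.\<close>
lemma basis_expansion_tendsto: "(\<lambda>n. \<Sum>j<n. (v \<bullet> e j) *\<^sub>R e j) \<longlonglongrightarrow> v"
proof -
  have ortho: "e i \<bullet> e j = (if i = j then 1 else 0)" for i j
    using e by (simp add: orthonormal_basis_def)
  define P where "P n v = (\<Sum>j<n. (v \<bullet> e j) *\<^sub>R e j)" for n v
  have P_diff: "P n (u - v) = P n u - P n v" for n u v
    by (simp add: P_def inner_diff scaleR_diff_left sum_subtractf)
  have coeff: "P n v \<bullet> e i = (\<Sum>j<n. if j = i then v \<bullet> e j else 0)" for n v i
    unfolding P_def inner_sum_left by (intro sum.cong) (auto simp: ortho)
  have "P n v \<bullet> P n v = (\<Sum>i<n. (v \<bullet> e i) * (P n v \<bullet> e i))" for n v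
    by (subst (2) P_def) (simp add: inner_sum_right)
  also have "\<And>n v. (\<Sum>i<n. (v \<bullet> e i) * (P n v \<bullet> e i)) = (\<Sum>i<n. (v \<bullet> e i) * (v \<bullet> e i))"
    unfolding coeff by (intro sum.cong) auto
  also have "\<And>n v. (\<Sum>i<n. (v \<bullet> e i) * (v \<bullet> e i)) = v \<bullet> P n v"
    by (simp add: P_def inner_sum_right)
  finally have "norm (P n v) * norm (P n v) \<le> norm v * norm (P n v)" for n v
    using Cauchy_Schwarz_ineq2[of v "P n v"] by (simp add: dot_square_norm power2_eq_square)
  then have P_le: "norm (P n v) \<le> norm v" for n v
    by (cases "P n v = 0") (simp_all add: mult_le_cancel_right)
  have span: "\<exists>N. \<forall>n\<ge>N. P n w = w" if "w \<in> span (range e)" for w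
    using that
  proof (induction rule: span_induct_alt)
    case base
    then show ?case by (simp add: P_def)
  next
    case (step c x y)
    then obtain N i where N: "\<forall>n\<ge>N. P n y = y" and x: "x = e i" by auto
    have "P n (c *\<^sub>R x + y) = c *\<^sub>R x + y" if n: "n \<ge> max N (Suc i)" for n
    proof -
      have "P n x = (\<Sum>j<n. if j = i then e j else 0)"
        unfolding P_def x by (intro sum.cong) (auto simp: ortho)
      also have "\<dots> = x" using n by (simp add: x)
      finally have "P n x = x" .
      moreover have "P n (c *\<^sub>R x + y) = c *\<^sub>R P n x + P n y"
        by (simp add: P_def inner_add scaleR_add_left sum.distrib scaleR_sum_right)
      ultimately show ?thesis using N n by simp
    qed
    then show ?case by blast
  qed
  have "(\<lambda>n. P n v) \<longlonglongrightarrow> v"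
  proof (rule metric_LIMSEQ_I)
    fix r :: real assume "r > 0"
    have "v \<in> closure (span (range e))" using e by (simp add: orthonormal_basis_def)
    then obtain w where w: "w \<in> span (range e)" "norm (w - v) < r / 2"
      using \<open>r > 0\<close> by (metis closure_approachable dist_norm half_gt_zero)
    obtain N where N: "\<And>n. n \<ge> N \<Longrightarrow> P n w = w" using span[OF w(1)] by blast
    have "dist (P n v) v < r" if "n \<ge> N" for n
    proof -
      have "P n v - v = (w - v) - P n (w - v)" using N[OF that] by (simp add: P_diff)
      then have "norm (P n v - v) \<le> norm (w - v) + norm (P n (w - v))"
        by (simp only: norm_triangle_ineq4)
      also have "\<dots> < r" using P_le[of n "w - v"] w(2) by simp
      finally show ?thesis by (simp add: dist_norm)
    qed
    then show "\<exists>N. \<forall>n\<ge>N. dist (P n v) v < r" by blast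
  qed
  then show ?thesis by (simp add: P_def)
qed

lemma parseval: "ennreal ((norm v)\<^sup>2) = (\<Sum>j. ennreal ((v \<bullet> e j)\<^sup>2))"
proof -
  have "(\<lambda>n. v \<bullet> (\<Sum>j<n. (v \<bullet> e j) *\<^sub>R e j)) \<longlonglongrightarrow> v \<bullet> v"
    by (intro tendsto_intros basis_expansion_tendsto)
  then have "(\<lambda>j. (v \<bullet> e j)\<^sup>2) sums (norm v)\<^sup>2"
    by (simp add: sums_def inner_sum_right power2_eq_square[symmetric] power2_norm_eq_inner)
  then show ?thesis by (intro suminf_ennreal_eq[symmetric]) simp
qed

end

lemma ennreal_suminf_swap:
  fixes f :: "nat \<Rightarrow> nat \<Rightarrow> ennreal"
  shows "(\<Sum>i. \<Sum>j. f i j) = (\<Sum>j. \<Sum>i. f i j)"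
  using nn_integral_suminf[of "\<lambda>i j. f i j" "count_space (UNIV :: nat set)"]
  by (simp add: nn_integral_count_space_nat)

section \<open>Second moments of independent sums\<close>

lemma normal_law_moments:
  assumes "v \<ge> 0"
  shows "integrable (normal_law 0 v) (\<lambda>x. x\<^sup>2)" "integral\<^sup>L (normal_law 0 v) (\<lambda>x. x\<^sup>2) = v"
    and "integral\<^sup>L (normal_law 0 v) (\<lambda>x. x) = 0"
proof -
  have "integrable (normal_law 0 v) (\<lambda>x. x\<^sup>2) \<and> integral\<^sup>L (normal_law 0 v) (\<lambda>x. x\<^sup>2) = v \<and>
    integral\<^sup>L (normal_law 0 v) (\<lambda>x. x) = 0"
  proof (cases "v = 0")
    case True
    have "integrable (return borel 0) (\<lambda>x::real. x\<^sup>2)"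
      by (rule integrableI_bounded) (simp_all add: nn_integral_return)
    then show ?thesis using True by (simp add: normal_law_def integral_return)
  next
    case False
    then have pos: "sqrt v > 0" using assms by simp
    have law: "normal_law 0 v = density lborel (normal_density 0 (sqrt v))"
      using False by (simp add: normal_law_def)
    have "has_bochner_integral lborel (\<lambda>x. normal_density 0 (sqrt v) x * x\<^sup>2) v"
      using normal_moment_even[OF pos, of 0 1] assms by (simp add: fact_2)
    moreover have "has_bochner_integral lborel (\<lambda>x. normal_density 0 (sqrt v) x * x) 0"
      using normal_moment_odd[OF pos, of 0 0] by simp
    ultimately show ?thesis
      unfolding law
      by (simp add: integrable_density integral_density has_bochner_integral_iff)
  qed
  then show "integrable (normal_law 0 v) (\<lambda>x. x\<^sup>2)" "integral\<^sup>L (normal_law 0 v) (\<lambda>x. x\<^sup>2) = v"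
    "integral\<^sup>L (normal_law 0 v) (\<lambda>x. x) = 0" by auto
qed

lemma (in prob_space) nn_integral_square_add_indep:
  fixes A B :: "'a \<Rightarrow> real"
  assumes ind: "indep_var borel A borel B" and [measurable]: "A \<in> borel_measurable M" "B \<in> borel_measurable M"
    and A: "(\<integral>\<^sup>+\<omega>. ennreal ((A \<omega>)\<^sup>2) \<partial>M) < \<infinity>" 
    and B: "integrable M (\<lambda>\<omega>. (B \<omega>)\<^sup>2)" "expectation B = 0"
  shows "(\<integral>\<^sup>+\<omega>. ennreal ((A \<omega> + B \<omega>)\<^sup>2) \<partial>M)
    = (\<integral>\<^sup>+\<omega>. ennreal ((A \<omega>)\<^sup>2) \<partial>M) + ennreal (expectation (\<lambda>\<omega>. (B \<omega>)\<^sup>2))"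
proof -
  have A2: "integrable M (\<lambda>\<omega>. (A \<omega>)\<^sup>2)" by (rule integrableI_bounded) (use A in simp_all)
  have A1: "integrable M A" by (rule square_integrable_imp_integrable[OF _ A2]) simp
  have B1: "integrable M B" by (rule square_integrable_imp_integrable[OF _ B(1)]) simp
  have AB: "integrable M (\<lambda>\<omega>. A \<omega> * B \<omega>)" "expectation (\<lambda>\<omega>. A \<omega> * B \<omega>) = 0"
    using indep_var_integrable[OF ind A1 B1] indep_var_lebesgue_integral[OF ind A1 B1] B(2) by auto
  have "integrable M (\<lambda>\<omega>. (A \<omega> + B \<omega>)\<^sup>2)"
    using A2 B(1) AB(1) by (simp add: power2_sum mult.assoc)
  then have "(\<integral>\<^sup>+\<omega>. ennreal ((A \<omega> + B \<omega>)\<^sup>2) \<partial>M) = ennreal (expectation (\<lambda>\<omega>. (A \<omega> + B \<omega>)\<^sup>2))"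
    by (rule nn_integral_eq_integral) simp
  also have "expectation (\<lambda>\<omega>. (A \<omega> + B \<omega>)\<^sup>2) = expectation (\<lambda>\<omega>. (A \<omega>)\<^sup>2) + expectation (\<lambda>\<omega>. (B \<omega>)\<^sup>2)"
    using A2 B(1) AB by (simp add: power2_sum mult.assoc)
  also have "ennreal \<dots> = (\<integral>\<^sup>+\<omega>. ennreal ((A \<omega>)\<^sup>2) \<partial>M) + ennreal (expectation (\<lambda>\<omega>. (B \<omega>)\<^sup>2))"
    using A2 by (subst ennreal_plus) (simp_all add: nn_integral_eq_integral)
  finally show ?thesis .
qed

text \<open>Both generated sigma-algebras are contained in the given independent families, the second of
  which is the sigma-algebra generated by \<open>N\<close>.\<close>
lemma (in prob_space) indep_var_if_indep_set_vimage:
  assumes ind: "indep_set (sets G) {N -` B \<inter> space M | B. B \<in> sets K}"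
    and G: "subalgebra M G" and A: "A \<in> borel_measurable G"
    and N: "N \<in> M \<rightarrow>\<^sub>M K" and f: "f \<in> borel_measurable K"
  shows "indep_var borel A borel (\<lambda>\<omega>. f (N \<omega>))"
  unfolding indep_var_eq
proof (intro conjI)
  show "random_variable borel A" by (rule measurable_from_subalg[OF G A])
  show "random_variable borel (\<lambda>\<omega>. f (N \<omega>))" using N f by (rule measurable_compose)
  let ?V = "vimage_algebra (space M) N K"
  have V: "sets ?V = {N -` B \<inter> space M | B. B \<in> sets K}"
    using N by (intro sets_vimage_algebra2) (auto dest: measurable_space)
  have NV: "N \<in> ?V \<rightarrow>\<^sub>M K"
    by (rule measurable_vimage_algebra1) (use N in \<open>auto dest: measurable_space\<close>)
  have "sigma_sets (space M) {A -` B \<inter> space M | B. B \<in> sets borel} \<subseteq> sets G"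
  proof -
    have sp: "space G = space M" using G by (simp add: subalgebra_def)
    show ?thesis unfolding sp[symmetric]
      by (rule sets.sigma_sets_subset) (use measurable_sets[OF A] in blast)
  qed
  moreover have "sigma_sets (space M) {(\<lambda>\<omega>. f (N \<omega>)) -` B \<inter> space M | B. B \<in> sets borel} \<subseteq> sets ?V"
  proof -
    have sp: "space ?V = space M" by simp
    have "sigma_sets (space ?V) {(\<lambda>\<omega>. f (N \<omega>)) -` B \<inter> space ?V | B. B \<in> sets borel} \<subseteq> sets ?V"
      by (rule sets.sigma_sets_subset) (use measurable_sets[OF measurable_compose[OF NV f]] in blast)
    then show ?thesis unfolding sp .
  qed
  ultimately show "indep_set (sigma_sets (space M) {A -` B \<inter> space M | B. B \<in> sets borel})
      (sigma_sets (space M) {(\<lambda>\<omega>. f (N \<omega>)) -` B \<inter> space M | B. B \<in> sets borel})" (is "indep_set ?A ?B")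
  proof (intro indep_setI)
    assume sub: "?A \<subseteq> sets G" "?B \<subseteq> sets ?V"
    note ind' = ind[folded V]
    show "?A \<subseteq> events" by (rule order_trans[OF sub(1) indep_setD_ev1[OF ind']])
    show "?B \<subseteq> events" by (rule order_trans[OF sub(2) indep_setD_ev2[OF ind']])
    show "prob (a \<inter> b) = prob a * prob b" if "a \<in> ?A" "b \<in> ?B" for a b
      using indep_setD[OF ind' subsetD[OF sub(1) that(1)] subsetD[OF sub(2) that(2)]] .
  qed
qed

lemma borel_measurable_inner_left: "(\<lambda>x :: 'h::real_inner. x \<bullet> h) \<in> borel_measurable borel"
  by (intro borel_measurable_continuous_onI continuous_intros)

section \<open>Expected energy after one step\<close>

lemma mulC_mulC: "a *\<^sub>C b *\<^sub>C u = (a * b) *\<^sub>C u"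
  by transfer (simp add: L2_rel_def square_integrable_cmult mult.assoc)

lemma norm_mulC_i: "norm (\<i> *\<^sub>C u) = norm u"
  using scaleR_eq_mulC[of 1 u] by (simp add: norm_eq_sqrt_inner mulC_adjoint mulC_mulC)

lemma diff_quot_mulC: "diff_quot i h (c *\<^sub>C u) = c *\<^sub>C diff_quot i h u"
  by (simp add: diff_quot_def translate_mulC mulC_diff mulC_scaleR)

lemma norm_diff_quot_group_mulC_i:
  assumes "schroedinger_group S"
  shows "norm (diff_quot i h (S t u)) = norm (diff_quot i h u)"
    and "norm (diff_quot i h (\<i> *\<^sub>C S t u)) = norm (diff_quot i h u)"
  using assms
  by (simp_all add: diff_quot_mulC norm_mulC_i diff_quot_schroedinger_group schroedinger_group_def
      unitary_norm[OF group_unitary])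

text \<open>In a space that is not known to be second countable, sums of Borel measurable maps are not
  evidently Borel measurable. Measurability of all functionals is stable under sums, and the energy
  depends on countably many of them only.\<close>
definition weakly_measurable :: "'w measure \<Rightarrow> ('w \<Rightarrow> 'h::real_inner) \<Rightarrow> bool"
  where "weakly_measurable M X \<longleftrightarrow> (\<forall>g. (\<lambda>\<omega>. X \<omega> \<bullet> g) \<in> borel_measurable M)"

lemma weakly_measurableD: "weakly_measurable M X \<Longrightarrow> (\<lambda>\<omega>. X \<omega> \<bullet> g) \<in> borel_measurable M"
  by (simp add: weakly_measurable_def)

lemma weakly_measurable_if_borel: "X \<in> borel_measurable M \<Longrightarrow> weakly_measurable M X"
  unfolding weakly_measurable_def using measurable_compose[OF _ borel_measurable_inner_left] by blast

lemma weakly_measurable_from_subalg: "subalgebra M G \<Longrightarrow> weakly_measurable G X \<Longrightarrow> weakly_measurable M X"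
  unfolding weakly_measurable_def using measurable_from_subalg by blast

context
  fixes e :: "nat \<Rightarrow> 'd::finite L2" and M :: "'w measure" and X :: "'w \<Rightarrow> 'd L2"
  assumes e: "orthonormal_basis e" and X: "weakly_measurable M X"
begin

lemma norm_diff_quot_measurable: "(\<lambda>\<omega>. ennreal ((norm (diff_quot i h (X \<omega>)))\<^sup>2)) \<in> borel_measurable M"
  unfolding parseval[OF e] diff_quot_adjoint using weakly_measurableD[OF X] by measurable

lemma dyadic_energy_measurable: "(\<lambda>\<omega>. dyadic_energy n (X \<omega>)) \<in> borel_measurable M"
  unfolding dyadic_energy_def using norm_diff_quot_measurable by measurable

lemma grad_normsq_measurable: "(\<lambda>\<omega>. grad_normsq (X \<omega>)) \<in> borel_measurable M"
  unfolding grad_normsq_eq_SUP using dyadic_energy_measurable by measurable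

end

lemma norm_diff_quot_le_grad_normsq: "ennreal ((norm (dyadic_quot i n u))\<^sup>2) \<le> grad_normsq u"
proof -
  have "ennreal ((norm (dyadic_quot i n u))\<^sup>2) \<le> dyadic_energy n u"
    unfolding dyadic_energy_def by (intro member_le_sum) auto
  also have "\<dots> \<le> grad_normsq u" unfolding grad_normsq_eq_SUP by (rule SUP_upper) simp
  finally show ?thesis .
qed

lemma nn_integral_grad_normsq_eq_SUP:
  fixes e :: "nat \<Rightarrow> 'd::finite L2" and X :: "'w \<Rightarrow> 'd L2"
  assumes "orthonormal_basis e" "weakly_measurable M X"
  shows "(\<integral>\<^sup>+\<omega>. grad_normsq (X \<omega>) \<partial>M) = (SUP n. \<integral>\<^sup>+\<omega>. dyadic_energy n (X \<omega>) \<partial>M)"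
  unfolding grad_normsq_eq_SUP
  by (intro nn_integral_monotone_convergence_SUP dyadic_energy_measurable[OF assms])
     (use incseq_dyadic_energy in \<open>auto simp: incseq_def le_fun_def\<close>)

lemma (in prob_space) centred_gaussian_second_moment:
  assumes "centred_gaussian M N C" "0 \<le> C g \<bullet> g"
  shows "integrable M (\<lambda>\<omega>. (N \<omega> \<bullet> g)\<^sup>2)" "expectation (\<lambda>\<omega>. (N \<omega> \<bullet> g)\<^sup>2) = C g \<bullet> g"
    and "expectation (\<lambda>\<omega>. N \<omega> \<bullet> g) = 0"
proof -
  have N: "(\<lambda>\<omega>. N \<omega> \<bullet> g) \<in> borel_measurable M"
    using assms(1) by (simp add: centred_gaussian_def weakly_measurableD weakly_measurable_if_borel)
  have law: "distr M borel (\<lambda>\<omega>. N \<omega> \<bullet> g) = normal_law 0 (C g \<bullet> g)"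
    using assms(1) by (simp add: centred_gaussian_def)
  note moments = normal_law_moments[OF assms(2), folded law]
  show "integrable M (\<lambda>\<omega>. (N \<omega> \<bullet> g)\<^sup>2)"
    using moments(1) by (subst (asm) integrable_distr_eq[OF N]) simp_all
  show "expectation (\<lambda>\<omega>. (N \<omega> \<bullet> g)\<^sup>2) = C g \<bullet> g"
    using moments(2) by (subst (asm) integral_distr[OF N]) simp_all
  show "expectation (\<lambda>\<omega>. N \<omega> \<bullet> g) = 0"
    using moments(3) by (subst (asm) integral_distr[OF N]) simp_all
qed

text \<open>Taking adjoints makes each coordinate of the new state a sum of a functional of the old state and a functional of
  the increment.\<close>
lemma inner_schroedinger_step:
  assumes "schroedinger_group S"
  shows "(S t x - \<i> *\<^sub>C S t y) \<bullet> g = x \<bullet> S (- t) g + y \<bullet> S (- t) (\<i> *\<^sub>C g)"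
proof -
  have "cnj \<i> *\<^sub>C g = - (\<i> *\<^sub>C g)"
    using mulC_mulC[of "-1" \<i> g] scaleR_eq_mulC[of "-1" "\<i> *\<^sub>C g"] by simp
  then show ?thesis
    using assms by (simp add: inner_diff_left mulC_adjoint schroedinger_group_def group_adjoint)
qed

context prob_space
begin

context
  fixes e :: "nat \<Rightarrow> 'd::finite L2" and S :: "real \<Rightarrow> 'd L2 \<Rightarrow> 'd L2" and Q R :: "'d L2 \<Rightarrow> 'd L2"
    and X N :: "'a \<Rightarrow> 'd L2" and G :: "'a measure" and k t :: real
  assumes e: "orthonormal_basis e" and S: "schroedinger_group S" and R: "is_sqrt_op R Q"
    and k: "0 \<le> k"
    and G: "subalgebra M G" and X: "weakly_measurable G X"
    and N: "centred_gaussian M N (\<lambda>g. k *\<^sub>R Q g)"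
    and ind: "indep_set (sets G) {N -` B \<inter> space M | B. B \<in> sets borel}"
    and fin: "(\<integral>\<^sup>+\<omega>. grad_normsq (X \<omega>) \<partial>M) < \<infinity>"
begin

lemma weakly_measurable_state: "weakly_measurable M X"
  by (rule weakly_measurable_from_subalg[OF G X])

lemma weakly_measurable_noise: "weakly_measurable M N"
  using N by (simp add: centred_gaussian_def weakly_measurable_if_borel)

lemma weakly_measurable_step: "weakly_measurable M (\<lambda>\<omega>. S t (X \<omega>) - \<i> *\<^sub>C S t (N \<omega>))"
  unfolding weakly_measurable_def inner_schroedinger_step[OF S]
  by (intro allI borel_measurable_add weakly_measurableD weakly_measurable_state weakly_measurable_noise)

text \<open>In coordinates, the quotient of the new state is \<open>X \<bullet> a\<^sub>j + N \<bullet> b\<^sub>j\<close>, a sum of independent square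
  integrable variables, the second of mean zero and variance \<open>k |R b\<^sub>j|\<^sup>2\<close>. The sum over \<open>j\<close> of these
  variances is a double series in \<open>R b\<^sub>j \<bullet> e\<^sub>l = b\<^sub>j \<bullet> R e\<^sub>l\<close>; summing over \<open>j\<close> first gives the quotients
  of the \<open>R e\<^sub>l\<close>.\<close>
lemma expectation_norm_diff_quot_step:
  "(\<integral>\<^sup>+\<omega>. ennreal ((norm (dyadic_quot i n (S t (X \<omega>) - \<i> *\<^sub>C S t (N \<omega>))))\<^sup>2) \<partial>M)
    = (\<integral>\<^sup>+\<omega>. ennreal ((norm (dyadic_quot i n (X \<omega>)))\<^sup>2) \<partial>M)
      + ennreal k * (\<Sum>l. ennreal ((norm (dyadic_quot i n (R (e l))))\<^sup>2))"
proof -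
  define g where "g j = - diff_quot i (- ((1/2) ^ n)) (e j)" for j
  define a where "a j = S (- t) (g j)" for j
  define b where "b j = S (- t) (\<i> *\<^sub>C g j)" for j
  have g: "dyadic_quot i n u \<bullet> e j = u \<bullet> g j" for u j
    by (simp add: g_def diff_quot_adjoint)
  have a: "x \<bullet> a j = dyadic_quot i n (S t x) \<bullet> e j" for x j
    using S by (simp add: g a_def schroedinger_group_def group_adjoint)
  have b: "y \<bullet> b j = - (dyadic_quot i n (\<i> *\<^sub>C S t y) \<bullet> e j)" for y j
  proof -
    have "S t 0 = 0"
      using S unitary_scaleR[OF group_unitary, of S t 0 0] by (simp add: schroedinger_group_def)
    then show ?thesis using inner_schroedinger_step[OF S, of t 0 y "g j"] by (simp add: g b_def)
  qed
  have R_sym: "R u \<bullet> v = u \<bullet> R v" for u v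
    using R by (simp add: is_sqrt_op_def nonneg_selfadjoint_def)
  have Q: "Q u \<bullet> u = (norm (R u))\<^sup>2" for u
    using R R_sym[of "R u" u] by (auto simp: is_sqrt_op_def power2_norm_eq_inner)
  have kQ: "(k *\<^sub>R Q u) \<bullet> u = k * (norm (R u))\<^sup>2" for u by (simp add: Q)
  have kQ_nonneg: "0 \<le> (k *\<^sub>R Q u) \<bullet> u" for u using k by (simp add: Q)
  note gauss = centred_gaussian_second_moment[OF N kQ_nonneg, unfolded kQ]
  have sum_a: "(\<Sum>j. ennreal ((x \<bullet> a j)\<^sup>2)) = ennreal ((norm (dyadic_quot i n x))\<^sup>2)" for x
    unfolding a by (simp only: parseval[OF e, symmetric] norm_diff_quot_group_mulC_i[OF S])
  have sum_b: "(\<Sum>j. ennreal ((y \<bullet> b j)\<^sup>2)) = ennreal ((norm (dyadic_quot i n y))\<^sup>2)" for y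
    unfolding b power2_minus by (simp only: parseval[OF e, symmetric] norm_diff_quot_group_mulC_i[OF S])
  \<comment> \<open>The square of a coordinate is dominated by the gradient norm, which has finite expectation.\<close>
  have fin_a: "(\<integral>\<^sup>+\<omega>. ennreal ((X \<omega> \<bullet> a j)\<^sup>2) \<partial>M) < \<infinity>" for j
  proof -
    have "ennreal ((x \<bullet> a j)\<^sup>2) \<le> grad_normsq x" for x
    proof -
      have "(\<Sum>j\<in>{j}. ennreal ((x \<bullet> a j)\<^sup>2)) \<le> (\<Sum>j. ennreal ((x \<bullet> a j)\<^sup>2))"
        by (rule sum_le_suminf) auto
      then have "ennreal ((x \<bullet> a j)\<^sup>2) \<le> ennreal ((norm (dyadic_quot i n x))\<^sup>2)"
        by (simp add: sum_a)
      then show ?thesis using norm_diff_quot_le_grad_normsq by (rule order_trans)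
    qed
    then have "(\<integral>\<^sup>+\<omega>. ennreal ((X \<omega> \<bullet> a j)\<^sup>2) \<partial>M) \<le> (\<integral>\<^sup>+\<omega>. grad_normsq (X \<omega>) \<partial>M)"
      by (intro nn_integral_mono)
    then show ?thesis using fin by (rule le_less_trans)
  qed
  have N_meas: "N \<in> borel_measurable M" using N by (simp add: centred_gaussian_def)
  have ind_ab: "indep_var borel (\<lambda>\<omega>. X \<omega> \<bullet> a j) borel (\<lambda>\<omega>. N \<omega> \<bullet> b j)" for j
    by (rule indep_var_if_indep_set_vimage[OF ind G weakly_measurableD[OF X] N_meas borel_measurable_inner_left])
  have per_coordinate: "(\<integral>\<^sup>+\<omega>. ennreal ((X \<omega> \<bullet> a j + N \<omega> \<bullet> b j)\<^sup>2) \<partial>M)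
      = (\<integral>\<^sup>+\<omega>. ennreal ((X \<omega> \<bullet> a j)\<^sup>2) \<partial>M) + ennreal k * ennreal ((norm (R (b j)))\<^sup>2)" for j
    using nn_integral_square_add_indep[OF ind_ab weakly_measurableD[OF weakly_measurable_state]
        weakly_measurableD[OF weakly_measurable_noise] fin_a gauss(1) gauss(3)]
    by (simp add: gauss(2) ennreal_mult k)
  have "(\<Sum>j. ennreal ((norm (R (b j)))\<^sup>2)) = (\<Sum>j. \<Sum>l. ennreal ((R (e l) \<bullet> b j)\<^sup>2))"
  proof -
    have "R (b j) \<bullet> e l = R (e l) \<bullet> b j" for j l
      using R_sym[of "b j" "e l"] by (simp only: inner_commute)
    then show ?thesis by (simp only: parseval[OF e, of "R _"])
  qed
  also have "\<dots> = (\<Sum>l. ennreal ((norm (dyadic_quot i n (R (e l))))\<^sup>2))"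
    by (subst ennreal_suminf_swap) (simp only: sum_b)
  finally have HS: "(\<Sum>j. ennreal ((norm (R (b j)))\<^sup>2)) = (\<Sum>l. ennreal ((norm (dyadic_quot i n (R (e l))))\<^sup>2))" .
  have [measurable]: "(\<lambda>\<omega>. X \<omega> \<bullet> u) \<in> borel_measurable M" "(\<lambda>\<omega>. N \<omega> \<bullet> u) \<in> borel_measurable M" for u
    by (rule weakly_measurableD weakly_measurable_state weakly_measurable_noise)+
  have "(\<integral>\<^sup>+\<omega>. ennreal ((norm (dyadic_quot i n (S t (X \<omega>) - \<i> *\<^sub>C S t (N \<omega>))))\<^sup>2) \<partial>M)
      = (\<integral>\<^sup>+\<omega>. (\<Sum>j. ennreal ((X \<omega> \<bullet> a j + N \<omega> \<bullet> b j)\<^sup>2)) \<partial>M)"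
    by (simp only: parseval[OF e, of "dyadic_quot i n _"] g inner_schroedinger_step[OF S] a_def b_def)
  also have "\<dots> = (\<Sum>j. \<integral>\<^sup>+\<omega>. ennreal ((X \<omega> \<bullet> a j + N \<omega> \<bullet> b j)\<^sup>2) \<partial>M)"
    by (rule nn_integral_suminf) measurable
  also have "\<dots> = (\<Sum>j. \<integral>\<^sup>+\<omega>. ennreal ((X \<omega> \<bullet> a j)\<^sup>2) \<partial>M) + ennreal k * (\<Sum>j. ennreal ((norm (R (b j)))\<^sup>2))"
    unfolding per_coordinate by (simp add: suminf_add[symmetric])
  also have "(\<Sum>j. \<integral>\<^sup>+\<omega>. ennreal ((X \<omega> \<bullet> a j)\<^sup>2) \<partial>M) = (\<integral>\<^sup>+\<omega>. ennreal ((norm (dyadic_quot i n (X \<omega>)))\<^sup>2) \<partial>M)"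
    unfolding sum_a[symmetric] by (rule nn_integral_suminf[symmetric]) measurable
  finally show ?thesis unfolding HS .
qed

lemma expectation_dyadic_energy_step:
  "(\<integral>\<^sup>+\<omega>. dyadic_energy n (S t (X \<omega>) - \<i> *\<^sub>C S t (N \<omega>)) \<partial>M)
    = (\<integral>\<^sup>+\<omega>. dyadic_energy n (X \<omega>) \<partial>M) + ennreal k * (\<Sum>l. dyadic_energy n (R (e l)))"
proof -
  have "(\<integral>\<^sup>+\<omega>. dyadic_energy n (S t (X \<omega>) - \<i> *\<^sub>C S t (N \<omega>)) \<partial>M)
    = (\<Sum>i\<in>UNIV. \<integral>\<^sup>+\<omega>. ennreal ((norm (dyadic_quot i n (S t (X \<omega>) - \<i> *\<^sub>C S t (N \<omega>))))\<^sup>2) \<partial>M)"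
    unfolding dyadic_energy_def
    by (rule nn_integral_sum) (rule norm_diff_quot_measurable[OF e weakly_measurable_step])
  also have "\<dots> = (\<Sum>i\<in>UNIV. \<integral>\<^sup>+\<omega>. ennreal ((norm (dyadic_quot i n (X \<omega>)))\<^sup>2) \<partial>M)
      + ennreal k * (\<Sum>i\<in>UNIV. \<Sum>l. ennreal ((norm (dyadic_quot i n (R (e l))))\<^sup>2))"
    unfolding expectation_norm_diff_quot_step by (simp only: sum.distrib sum_distrib_left)
  also have "(\<Sum>i\<in>UNIV. \<integral>\<^sup>+\<omega>. ennreal ((norm (dyadic_quot i n (X \<omega>)))\<^sup>2) \<partial>M) = (\<integral>\<^sup>+\<omega>. dyadic_energy n (X \<omega>) \<partial>M)"
    unfolding dyadic_energy_def
    by (rule nn_integral_sum[symmetric]) (rule norm_diff_quot_measurable[OF e weakly_measurable_state])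
  also have "(\<Sum>i\<in>UNIV. \<Sum>l. ennreal ((norm (dyadic_quot i n (R (e l))))\<^sup>2)) = (\<Sum>l. dyadic_energy n (R (e l)))"
    unfolding dyadic_energy_def by (rule suminf_sum[symmetric]) simp
  finally show ?thesis .
qed

text \<open>Monotone convergence in \<open>n\<close>: both terms on the right of the identity for the dyadic energies increase.\<close>
lemma expectation_grad_normsq_step:
  "(\<integral>\<^sup>+\<omega>. grad_normsq (S t (X \<omega>) - \<i> *\<^sub>C S t (N \<omega>)) \<partial>M)
    = (\<integral>\<^sup>+\<omega>. grad_normsq (X \<omega>) \<partial>M) + ennreal k * grad_HS_normsq e R"
proof -
  have inc1: "incseq (\<lambda>n. \<integral>\<^sup>+\<omega>. dyadic_energy n (X \<omega>) \<partial>M)"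
    using incseq_dyadic_energy by (auto simp: incseq_def intro!: nn_integral_mono)
  have inc2: "incseq (\<lambda>n. ennreal k * (\<Sum>l. dyadic_energy n (R (e l))))"
    using incseq_dyadic_energy by (auto simp: incseq_def intro!: mult_left_mono suminf_le)
  have "(\<integral>\<^sup>+\<omega>. grad_normsq (S t (X \<omega>) - \<i> *\<^sub>C S t (N \<omega>)) \<partial>M)
    = (SUP n. (\<integral>\<^sup>+\<omega>. dyadic_energy n (X \<omega>) \<partial>M) + ennreal k * (\<Sum>l. dyadic_energy n (R (e l))))"
    unfolding nn_integral_grad_normsq_eq_SUP[OF e weakly_measurable_step] expectation_dyadic_energy_step ..
  also have "\<dots> = (SUP n. \<integral>\<^sup>+\<omega>. dyadic_energy n (X \<omega>) \<partial>M)
      + (SUP n. ennreal k * (\<Sum>l. dyadic_energy n (R (e l))))"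
    by (rule ennreal_SUP_add[OF inc1 inc2])
  also have "(SUP n. \<integral>\<^sup>+\<omega>. dyadic_energy n (X \<omega>) \<partial>M) = (\<integral>\<^sup>+\<omega>. grad_normsq (X \<omega>) \<partial>M)"
    by (rule nn_integral_grad_normsq_eq_SUP[OF e weakly_measurable_state, symmetric])
  also have "(SUP n. ennreal k * (\<Sum>l. dyadic_energy n (R (e l))))
      = ennreal k * (SUP n. \<Sum>l. dyadic_energy n (R (e l)))"
    by (rule SUP_mult_left_ennreal[symmetric])
  also have "(SUP n. \<Sum>l. dyadic_energy n (R (e l))) = grad_HS_normsq e R"
    unfolding grad_HS_normsq_def grad_normsq_eq_SUP
    by (rule ennreal_suminf_SUP_eq[symmetric]) (rule incseq_dyadic_energy)
  finally show ?thesis .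
qed

end
end

theorem proposition3p8:
  fixes P :: "'w measure" and F :: "real \<Rightarrow> 'w measure"
    and S :: "real \<Rightarrow> 'd::finite L2 \<Rightarrow> 'd L2"
    and Q Qhalf :: "'d L2 \<Rightarrow> 'd L2"
    and e :: "nat \<Rightarrow> 'd L2"
    and W :: "real \<Rightarrow> 'w \<Rightarrow> 'd L2" and u0 :: "'w \<Rightarrow> 'd L2"
    and k :: real
  defines "u \<equiv> exp_integrator S k W u0"
    and "TrQ \<equiv> grad_HS_normsq e Qhalf"
  assumes "prob_space P" and "normal_filtration P F"
    and "schroedinger_group S"
    and "nonneg_selfadjoint Q" and "trace_class Q"
    and "is_sqrt_op Qhalf Q"
    and "orthonormal_basis e"
    and "Q_wiener_process P F Q W"
    and "\<forall>t\<ge>0. (\<integral>\<^sup>+\<omega>. ennreal ((norm (W t \<omega>))\<^sup>2) \<partial>P) < \<infinity>"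
    and "u0 \<in> borel_measurable (F 0)"
    and "k > 0"
    and "(\<integral>\<^sup>+\<omega>. energy (u0 \<omega>) \<partial>P) < \<infinity>"
    and "TrQ < \<infinity>"
  shows "\<forall>n\<ge>1.
    (\<integral>\<^sup>+\<omega>. energy (u n \<omega>) \<partial>P) = (\<integral>\<^sup>+\<omega>. energy (u (n - 1) \<omega>) \<partial>P) + ennreal (k / 2) * TrQ \<and>
    (\<integral>\<^sup>+\<omega>. energy (u (n - 1) \<omega>) \<partial>P) + ennreal (k / 2) * TrQ
      = (\<integral>\<^sup>+\<omega>. energy (u0 \<omega>) \<partial>P) + ennreal (real n * k / 2) * TrQ"
proof -
  interpret prob_space P by fact
  note S = \<open>schroedinger_group S\<close> and e = \<open>orthonormal_basis e\<close> and R = \<open>is_sqrt_op Qhalf Q\<close>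
  define T where "T n = real n * k" for n
  have T: "0 \<le> T n" "T n < T (Suc n)" "T (Suc n) - T n = k" for n
    using \<open>k > 0\<close> by (simp_all add: T_def algebra_simps)
  have sub: "subalgebra P (F t)" if "t \<ge> 0" for t
    using assms(4) that by (simp add: normal_filtration_def)
  have mono: "subalgebra (F t) (F s)" if "0 \<le> s" "s \<le> t" for s t
  proof -
    have "sets (F s) \<subseteq> sets (F t)"
      using assms(4) that unfolding normal_filtration_def by blast
    moreover have "space (F s) = space (F t)"
      using sub[of s] sub[of t] that by (simp add: subalgebra_def)
    ultimately show ?thesis by (simp add: subalgebra_def)
  qed
  have u_Suc: "u (Suc n) = (\<lambda>\<omega>. S k (u n \<omega>) - \<i> *\<^sub>C S k (W (T (Suc n)) \<omega> - W (T n) \<omega>))" for n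
    by (simp add: u_def T_def)
  have W_meas: "weakly_measurable (F t) (W t)" if "t \<ge> 0" for t
    using assms(10) that unfolding Q_wiener_process_def by (blast intro: weakly_measurable_if_borel)
  have u_meas: "weakly_measurable (F (T n)) (u n)" for n
  proof (induction n)
    case 0
    show ?case using weakly_measurable_if_borel[OF assms(12)] by (simp add: u_def T_def)
  next
    case (Suc n)
    have sub_Suc: "subalgebra (F (T (Suc n))) (F (T n))"
      by (rule mono[OF T(1) less_imp_le[OF T(2)]])
    show ?case
      unfolding u_Suc weakly_measurable_def inner_schroedinger_step[OF S] unfolding inner_diff_left
      by (intro allI borel_measurable_add borel_measurable_diff weakly_measurableD W_meas T(1)
          weakly_measurable_from_subalg[OF sub_Suc] Suc.IH)
  qed
  have u_measP: "weakly_measurable P (u n)" for n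
    by (rule weakly_measurable_from_subalg[OF sub[OF T(1)] u_meas])
  have energy: "(\<integral>\<^sup>+\<omega>. energy (u n \<omega>) \<partial>P) = (\<integral>\<^sup>+\<omega>. grad_normsq (u n \<omega>) \<partial>P) / 2" for n
    unfolding energy_def by (rule nn_integral_divide) (rule grad_normsq_measurable[OF e u_measP])
  have step: "(\<integral>\<^sup>+\<omega>. grad_normsq (u (Suc n) \<omega>) \<partial>P) = (\<integral>\<^sup>+\<omega>. grad_normsq (u n \<omega>) \<partial>P) + ennreal k * TrQ"
    if "(\<integral>\<^sup>+\<omega>. grad_normsq (u n \<omega>) \<partial>P) < \<infinity>" for n
    unfolding u_Suc TrQ_def
  proof (rule expectation_grad_normsq_step[OF e S R _ sub[OF T(1)] u_meas _ _ that])
    have wiener: "indep_set (sets (F (T n)))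
        {(\<lambda>\<omega>. W (T (Suc n)) \<omega> - W (T n) \<omega>) -` B \<inter> space P | B. B \<in> sets borel} \<and>
      centred_gaussian P (\<lambda>\<omega>. W (T (Suc n)) \<omega> - W (T n) \<omega>) (\<lambda>h. (T (Suc n) - T n) *\<^sub>R Q h)"
      using assms(10) T(1)[of n] T(2)[of n] unfolding Q_wiener_process_def by blast
    show "centred_gaussian P (\<lambda>\<omega>. W (T (Suc n)) \<omega> - W (T n) \<omega>) (\<lambda>h. k *\<^sub>R Q h)"
      using wiener by (simp only: T(3))
    show "indep_set (sets (F (T n)))
        {(\<lambda>\<omega>. W (T (Suc n)) \<omega> - W (T n) \<omega>) -` B \<inter> space P | B. B \<in> sets borel}"
      using wiener by blast
  qed (use \<open>k > 0\<close> in simp)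
  have u_0: "u 0 = u0" by (simp add: u_def)
  have fin: "(\<integral>\<^sup>+\<omega>. grad_normsq (u n \<omega>) \<partial>P) < \<infinity>" for n
  proof (induction n)
    case 0
    show ?case
      using assms(14) energy[of 0]
      by (cases "(\<integral>\<^sup>+\<omega>. grad_normsq (u0 \<omega>) \<partial>P) = \<top>")
         (auto simp: u_0 ennreal_top_divide top.not_eq_extremum)
  next
    case (Suc n)
    then show ?case using assms(15) by (simp add: step ennreal_mult_less_top)
  qed
  have energy_step: "(\<integral>\<^sup>+\<omega>. energy (u (Suc n) \<omega>) \<partial>P) = (\<integral>\<^sup>+\<omega>. energy (u n \<omega>) \<partial>P) + ennreal (k / 2) * TrQ" for n
  proof -
    have "ennreal k * TrQ / 2 = ennreal (k / 2) * TrQ"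
      using \<open>k > 0\<close> by (simp add: divide_ennreal_def ennreal_mult mult_ac flip: divide_ennreal)
    then show ?thesis unfolding energy step[OF fin] by (simp add: add_divide_distrib_ennreal)
  qed
  have energy_n: "(\<integral>\<^sup>+\<omega>. energy (u n \<omega>) \<partial>P) = (\<integral>\<^sup>+\<omega>. energy (u0 \<omega>) \<partial>P) + ennreal (real n * k / 2) * TrQ" for n
  proof (induction n)
    case 0
    show ?case by (simp add: u_0)
  next
    case (Suc n)
    have "ennreal (real n * k / 2) * TrQ + ennreal (k / 2) * TrQ = ennreal (real (Suc n) * k / 2) * TrQ"
      using \<open>k > 0\<close> by (simp add: distrib_right[symmetric] add_divide_distrib flip: ennreal_plus)
        (simp add: algebra_simps add_divide_distrib)
    then show ?case unfolding energy_step Suc.IH by (simp add: add.assoc)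
  qed
  show ?thesis
  proof (intro allI impI)
    fix n :: nat assume "n \<ge> 1"
    then obtain m where "n = Suc m" by (cases n) auto
    then show "(\<integral>\<^sup>+\<omega>. energy (u n \<omega>) \<partial>P) = (\<integral>\<^sup>+\<omega>. energy (u (n - 1) \<omega>) \<partial>P) + ennreal (k / 2) * TrQ \<and>
      (\<integral>\<^sup>+\<omega>. energy (u (n - 1) \<omega>) \<partial>P) + ennreal (k / 2) * TrQ
        = (\<integral>\<^sup>+\<omega>. energy (u0 \<omega>) \<partial>P) + ennreal (real n * k / 2) * TrQ"
      using energy_step[of m] energy_n[of n] by simp
  qed
qed

end
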